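(* Let $\mathbb{K}$ be a field of characteristic $0$ and let $L$ be a split $\delta$ Jordan-Lie algebra over $\mathbb{K}$ (of arbitrary dimension) with a symmetric root system $\Lambda$. Suppose that $L$ is root-multiplicative, $\mathrm{Z}(L)=0$, $[L,L]=L$, and $\dim L_\alpha=1$ for every $\alpha\in\Lambda$. Then $L$ is the direct sum of the family of its minimal ideals, each one being a simple split $\delta$ Jordan-Lie algebra with a symmetric root system and having all its nonzero roots connected.
   Context: Let $\delta\in\{1,-1\}$. A $\delta$ Jordan-Lie algebra is a vector space $L$ over a field $\mathbb{K}$ with a bilinear map $[\cdot,\cdot]:L\times L\to L$ satisfying $[x,y]=-\delta[y,x]$ and $[x,[y,z]]=\delta[[x,y],z]+\delta[y,[x,z]]$ for all $x,y,z\in L$. Put $(\mathrm{ad}\,x)y:=\delta[x,y]$. The center is $\mathrm{Z}(L)=\{v\in L:[v,L]=0\}$. A splitting Cartan subalgebra $H$ of $L$ is a maximal abelian subalgebra such that the maps $\mathrm{ad}(h)$, $h\in H$, are simultaneously diagonalizable; $L$ is split if it contains such an $H$ (which is then fixed). This means that there is a root decomposition $L=H\oplus(\oplus_{\alpha\in\Lambda}L_\alpha)$, where for $\alpha\in H^*$, $L_\alpha=\{v\in L:[h,v]=\alpha(h)v\text{ for all }h\in H\}$, and $\Lambda=\{\alpha\in H^*\setminus\{0\}:L_\alpha\neq0\}$ is the root system (the set of nonzero roots). $\Lambda$ is symmetric if $\alpha\in\Lambda$ implies $-\alpha\in\Lambda$. Connections: for $\alpha,\beta\in\Lambda$, $\alpha$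 and $\beta$ are connected if there are $n\ge1$ and $\alpha_1,\dots,\alpha_n\in\Lambda$ such that, with $s_k:=\delta^{k-1}\alpha_1+\sum_{i=1}^{k-1}\delta^{k-i}\alpha_{i+1}$ (so $s_1=\alpha_1$, $s_2=\delta(\alpha_1+\alpha_2)$, $s_3=\alpha_1+\alpha_2+\delta\alpha_3$, and so on), one has $\alpha_1=\alpha$; $s_1,\dots,s_{n-1}\in\Lambda$ (when $n\ge2$); and $s_n=\pm\beta$. A split $\delta$ Jordan-Lie algebra has all its nonzero roots connected if any two elements of its root system are connected (through elements of that root system). $L$ is root-multiplicative if $\alpha,\beta,\alpha+\beta\in\Lambda$ implies $[L_\alpha,L_\beta]\neq0$. *)

theory Defs
  imports Complex_Main
begin

(* An algebra is given by a carrier set L inside an ambient vector space (scale) and a bracket br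
   that is only constrained on L.  Thus an ideal I of L is itself an algebra, with carrier I and
   the same scale and br. *)

locale delta_jordan_lie = vector_space scale
  for scale :: "'k::field \<Rightarrow> 'v::ab_group_add \<Rightarrow> 'v" +
  fixes br :: "'v \<Rightarrow> 'v \<Rightarrow> 'v" and \<delta> :: 'k and L :: "'v set"
  assumes delta: "\<delta> = 1 \<or> \<delta> = - 1"
    and subspace_carrier: "subspace L"
    and br_closed: "\<lbrakk>x \<in> L; y \<in> L\<rbrakk> \<Longrightarrow> br x y \<in> L"
    and br_add_left: "\<lbrakk>x \<in> L; y \<in> L; z \<in> L\<rbrakk> \<Longrightarrow> br (x + y) z = br x z + br y z"
    and br_add_right: "\<lbrakk>x \<in> L; y \<in> L; z \<in> L\<rbrakk> \<Longrightarrow> br x (y + z) = br x y + br x z"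
    and br_scale_left: "\<lbrakk>x \<in> L; y \<in> L\<rbrakk> \<Longrightarrow> br (scale c x) y = scale c (br x y)"
    and br_scale_right: "\<lbrakk>x \<in> L; y \<in> L\<rbrakk> \<Longrightarrow> br x (scale c y) = scale c (br x y)"
    and br_skew: "\<lbrakk>x \<in> L; y \<in> L\<rbrakk> \<Longrightarrow> br x y = - scale \<delta> (br y x)"
    and br_jacobi: "\<lbrakk>x \<in> L; y \<in> L; z \<in> L\<rbrakk> \<Longrightarrow>
      br x (br y z) = scale \<delta> (br (br x y) z) + scale \<delta> (br y (br x z))"

definition direct_sum :: "'v::ab_group_add set \<Rightarrow> 'i set \<Rightarrow> ('i \<Rightarrow> 'v set) \<Rightarrow> bool" where
  "direct_sum L J V \<longleftrightarrow> (\<forall>j\<in>J. V j \<subseteq> L) \<and>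
     (\<forall>v\<in>L. \<exists>!f. (\<forall>j\<in>J. f j \<in> V j) \<and> (\<forall>j. j \<notin> J \<longrightarrow> f j = 0) \<and>
        finite {j. f j \<noteq> 0} \<and> v = (\<Sum>j\<in>{j. f j \<noteq> 0}. f j))"

context
  fixes scale :: "'k::field \<Rightarrow> 'v::ab_group_add \<Rightarrow> 'v"
    and br :: "'v \<Rightarrow> 'v \<Rightarrow> 'v"
begin

definition ad :: "'k \<Rightarrow> 'v \<Rightarrow> 'v \<Rightarrow> 'v" where
  "ad \<delta> x y = scale \<delta> (br x y)"

(* [A, B] is the linear span of all brackets. *)
definition bracket_space :: "'v set \<Rightarrow> 'v set \<Rightarrow> 'v set" where
  "bracket_space A B = module.span scale {br a b | a b. a \<in> A \<and> b \<in> B}"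

definition center :: "'v set \<Rightarrow> 'v set" where
  "center L = {v \<in> L. \<forall>x\<in>L. br v x = 0}"

(* Two-sidedness is automatic from br x y = - \<delta> (br y x). *)
definition is_ideal :: "'v set \<Rightarrow> 'v set \<Rightarrow> bool" where
  "is_ideal L I \<longleftrightarrow> module.subspace scale I \<and> I \<subseteq> L \<and> (\<forall>x\<in>I. \<forall>y\<in>L. br x y \<in> I)"

definition minimal_ideal :: "'v set \<Rightarrow> 'v set \<Rightarrow> bool" where
  "minimal_ideal L I \<longleftrightarrow> is_ideal L I \<and> I \<noteq> {0} \<and>
     (\<forall>J. is_ideal L J \<and> J \<subseteq> I \<longrightarrow> J = {0} \<or> J = I)"

definition simple_algebra :: "'v set \<Rightarrow> bool" where
  "simple_algebra L \<longleftrightarrow> bracket_space L L \<noteq> {0} \<and>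
     (\<forall>I. is_ideal L I \<longrightarrow> I = {0} \<or> I = L)"

definition abelian_subalgebra :: "'v set \<Rightarrow> 'v set \<Rightarrow> bool" where
  "abelian_subalgebra L H \<longleftrightarrow> module.subspace scale H \<and> H \<subseteq> L \<and> (\<forall>x\<in>H. \<forall>y\<in>H. br x y = 0)"

definition maximal_abelian_subalgebra :: "'v set \<Rightarrow> 'v set \<Rightarrow> bool" where
  "maximal_abelian_subalgebra L H \<longleftrightarrow> abelian_subalgebra L H \<and>
     (\<forall>A. abelian_subalgebra L A \<and> H \<subseteq> A \<longrightarrow> A = H)"

definition ad_simultaneously_diagonalizable :: "'k \<Rightarrow> 'v set \<Rightarrow> 'v set \<Rightarrow> bool" where
  "ad_simultaneously_diagonalizable \<delta> L H \<longleftrightarrow>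
     (\<exists>B. B \<subseteq> L \<and> \<not> module.dependent scale B \<and> module.span scale B = L \<and>
        (\<forall>b\<in>B. \<forall>h\<in>H. \<exists>c. ad \<delta> h b = scale c b))"

(* Linear functionals on H, represented by functions on the ambient type that vanish off H, so
   that equality and the pointwise operations on them are those of H*. *)
definition dual :: "'v set \<Rightarrow> ('v \<Rightarrow> 'k) set" where
  "dual H = {\<alpha>. (\<forall>x\<in>H. \<forall>y\<in>H. \<alpha> (x + y) = \<alpha> x + \<alpha> y) \<and>
                (\<forall>c. \<forall>x\<in>H. \<alpha> (scale c x) = c * \<alpha> x) \<and>
                (\<forall>x. x \<notin> H \<longrightarrow> \<alpha> x = 0)}"

definition root_space :: "'v set \<Rightarrow> 'v set \<Rightarrow> ('v \<Rightarrow> 'k) \<Rightarrow> 'v set" where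
  "root_space L H \<alpha> = {v \<in> L. \<forall>h\<in>H. br h v = scale (\<alpha> h) v}"

definition roots :: "'v set \<Rightarrow> 'v set \<Rightarrow> ('v \<Rightarrow> 'k) set" where
  "roots L H = {\<alpha> \<in> dual H. \<alpha> \<noteq> (\<lambda>_. 0) \<and> root_space L H \<alpha> \<noteq> {0}}"

(* L = H + (sum of the root spaces), direct; the summand H gets the zero functional as index. *)
definition root_decomposition :: "'v set \<Rightarrow> 'v set \<Rightarrow> bool" where
  "root_decomposition L H \<longleftrightarrow>
     direct_sum L (insert (\<lambda>_. 0) (roots L H))
       (\<lambda>\<alpha>. if \<alpha> = (\<lambda>_. 0) then H else root_space L H \<alpha>)"

(* For \<delta> = 1 and characteristic not 2 the first two conditions imply the third.  For \<delta> = -1 they do not: on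
   span {x, z} with [x, x] = z and all other brackets 0, H = span {z} satisfies the first two
   but the zero weight space is larger than H. *)
definition splitting_cartan :: "'k \<Rightarrow> 'v set \<Rightarrow> 'v set \<Rightarrow> bool" where
  "splitting_cartan \<delta> L H \<longleftrightarrow> maximal_abelian_subalgebra L H \<and>
     ad_simultaneously_diagonalizable \<delta> L H \<and> root_decomposition L H"

definition root_multiplicative :: "'v set \<Rightarrow> 'v set \<Rightarrow> bool" where
  "root_multiplicative L H \<longleftrightarrow>
     (\<forall>\<alpha>\<in>roots L H. \<forall>\<beta>\<in>roots L H. (\<lambda>h. \<alpha> h + \<beta> h) \<in> roots L H \<longrightarrow>
        bracket_space (root_space L H \<alpha>) (root_space L H \<beta>) \<noteq> {0})"

end

definition symmetric_roots :: "('v \<Rightarrow> 'k::field) set \<Rightarrow> bool" where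
  "symmetric_roots \<Lambda> \<longleftrightarrow> (\<forall>\<alpha>\<in>\<Lambda>. (\<lambda>h. - \<alpha> h) \<in> \<Lambda>)"

definition connection_sum :: "'k::field \<Rightarrow> (nat \<Rightarrow> 'v \<Rightarrow> 'k) \<Rightarrow> nat \<Rightarrow> 'v \<Rightarrow> 'k" where
  "connection_sum \<delta> a k =
     (\<lambda>h. \<delta> ^ (k - 1) * a 1 h + (\<Sum>i = 1..k - 1. \<delta> ^ (k - i) * a (i + 1) h))"

definition connected_roots ::
    "'k::field \<Rightarrow> ('v \<Rightarrow> 'k) set \<Rightarrow> ('v \<Rightarrow> 'k) \<Rightarrow> ('v \<Rightarrow> 'k) \<Rightarrow> bool" where
  "connected_roots \<delta> \<Lambda> \<alpha> \<beta> \<longleftrightarrow>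
     (\<exists>n a. n \<ge> 1 \<and> (\<forall>i\<in>{1..n}. a i \<in> \<Lambda>) \<and> a 1 = \<alpha> \<and>
        (\<forall>k\<in>{1..<n}. connection_sum \<delta> a k \<in> \<Lambda>) \<and>
        (connection_sum \<delta> a n = \<beta> \<or> connection_sum \<delta> a n = (\<lambda>h. - \<beta> h)))"

definition all_roots_connected :: "'k::field \<Rightarrow> ('v \<Rightarrow> 'k) set \<Rightarrow> bool" where
  "all_roots_connected \<delta> \<Lambda> \<longleftrightarrow> (\<forall>\<alpha>\<in>\<Lambda>. \<forall>\<beta>\<in>\<Lambda>. connected_roots \<delta> \<Lambda> \<alpha> \<beta>)"

end

theory Submission
  imports Defs
begin

text \<open>If \<open>\<delta> = - 1\<close>, the Jacobi identity forces \<open>(ad h)\<^sup>2 = 0\<close> for \<open>h \<in> H\<close>, so there are no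
  roots and \<open>L = [L, L] = 0\<close>.  If \<open>\<delta> = 1\<close>, split the roots into connectedness classes.  Each class
  \<open>C\<close> spans, together with the brackets \<open>[L\<^sub>\<alpha>, L\<^sub>-\<^sub>\<alpha>]\<close> for \<open>\<alpha> \<in> C\<close>, an ideal \<open>I\<^sub>C\<close>; distinct
  such ideals annihilate each other, they generate \<open>L = [L, L]\<close>, and their sum is direct because
  \<open>Z(L) = 0\<close>.  A nonzero ideal is \<open>H\<close>-stable, hence homogeneous, so as \<open>Z(L) = 0\<close> it meets and
  therefore contains some \<open>L\<^sub>\<alpha>\<close>, and by root-multiplicativity the whole ideal of the class of
  \<open>\<alpha>\<close>.  So the ideals \<open>I\<^sub>C\<close> are exactly the minimal ideals.\<close>

section \<open>Linear algebra\<close>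

text \<open>What needs an idea beyond the overview is that each I_C is again split. Its Cartan
  subalgebra is K_C, the span of the brackets [L_\<alpha>, L_-\<alpha>] with \<alpha> in C, and its
  roots are the restrictions to K_C of the roots in C, so a root must be recoverable from its
  restriction. Two facts make it so. Perfectness forces H to be the sum of all K_C, since a bracket
  of weight vectors reaches H nontrivially only from opposite root spaces. And a root of C vanishes
  on K_D for every other class D, because K_D annihilates the root vectors of C. Hence a root of C
  is determined by its values on K_C. This one observation shows that no root of C vanishes on K_C,
  that restriction is injective on C, and that a K_C-weight vector in I_C is an H-weight vector,
  which makes K_C maximal abelian in I_C. It also replaces the classical argument that a root is
  nonzero on its own coroot: nonvanishing is obtained only for some coroot of the class.\<close>

lemma (in vector_space) direct_sumI:
  assumes sub: "\<And>j. j \<in> J \<Longrightarrow> subspace (V j)"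
    and le: "\<And>j. j \<in> J \<Longrightarrow> V j \<subseteq> L"
    and gen: "L \<subseteq> span (\<Union>j\<in>J. V j)"
    and indep: "\<And>F f. \<lbrakk>finite F; F \<subseteq> J; \<And>j. j \<in> F \<Longrightarrow> f j \<in> V j; sum f F = 0\<rbrakk> \<Longrightarrow> \<forall>j\<in>F. f j = 0"
  shows "direct_sum L J V"
  unfolding direct_sum_def
proof (intro conjI ballI)
  fix j assume "j \<in> J" then show "V j \<subseteq> L" by (rule le)
next
  fix v assume "v \<in> L"
  then have "v \<in> span (\<Union>j\<in>J. V j)" using gen by blast
  then have "\<exists>f. (\<forall>j\<in>J. f j \<in> V j) \<and> (\<forall>j. j \<notin> J \<longrightarrow> f j = 0) \<and>
        finite {j. f j \<noteq> 0} \<and> v = (\<Sum>j\<in>{j. f j \<noteq> 0}. f j)"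
  proof (induction rule: span_induct_alt)
    case base
    show ?case by (intro exI[of _ "\<lambda>_. 0"]) (auto simp: subspace_0 sub)
  next
    case (step c x y)
    then obtain i f where i: "i \<in> J" "x \<in> V i"
      and f: "\<forall>j\<in>J. f j \<in> V j" "\<forall>j. j \<notin> J \<longrightarrow> f j = 0" "finite {j. f j \<noteq> 0}"
        "y = (\<Sum>j\<in>{j. f j \<noteq> 0}. f j)"
      by auto
    define g where "g = f(i := scale c x + f i)"
    \<comment> \<open>The index \<open>i\<close> may be new to the support, or cancellation may
      remove it, so both sums are compared over one common finite set.\<close>
    define F where "F = insert i {j. f j \<noteq> 0}"
    have F: "finite F" using f by (simp add: F_def)
    have gF: "{j. g j \<noteq> 0} \<subseteq> F" by (auto simp: g_def F_def)
    have yF: "y = sum f F"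
      unfolding f(4) by (rule sum.mono_neutral_left) (use F in \<open>auto simp: F_def\<close>)
    have "sum g F = g i + sum g (F - {i})"
      using F by (rule sum.remove) (simp add: F_def)
    also have "sum g (F - {i}) = sum f (F - {i})"
      by (rule sum.cong) (auto simp: g_def)
    also have "g i + \<dots> = scale c x + (f i + sum f (F - {i}))" by (simp add: g_def add.assoc)
    also have "f i + sum f (F - {i}) = sum f F"
      using F by (rule sum.remove[symmetric]) (simp add: F_def)
    finally have "scale c x + y = sum g F" by (simp add: yF)
    also have "\<dots> = (\<Sum>j\<in>{j. g j \<noteq> 0}. g j)"
      by (rule sum.mono_neutral_right) (use F gF in auto)
    finally have "scale c x + y = (\<Sum>j\<in>{j. g j \<noteq> 0}. g j)" .
    moreover have "\<forall>j\<in>J. g j \<in> V j"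
      using f(1) i sub by (auto simp: g_def subspace_add subspace_scale)
    moreover have "\<forall>j. j \<notin> J \<longrightarrow> g j = 0" using f(2) i by (auto simp: g_def)
    ultimately show ?case using finite_subset[OF gF F] by blast
  qed
  then show "\<exists>!f. (\<forall>j\<in>J. f j \<in> V j) \<and> (\<forall>j. j \<notin> J \<longrightarrow> f j = 0) \<and>
        finite {j. f j \<noteq> 0} \<and> v = (\<Sum>j\<in>{j. f j \<noteq> 0}. f j)"
  proof (rule ex_ex1I)
    fix f g
    assume f: "(\<forall>j\<in>J. f j \<in> V j) \<and> (\<forall>j. j \<notin> J \<longrightarrow> f j = 0) \<and>
        finite {j. f j \<noteq> 0} \<and> v = (\<Sum>j\<in>{j. f j \<noteq> 0}. f j)"
      and g: "(\<forall>j\<in>J. g j \<in> V j) \<and> (\<forall>j. j \<notin> J \<longrightarrow> g j = 0) \<and>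
        finite {j. g j \<noteq> 0} \<and> v = (\<Sum>j\<in>{j. g j \<noteq> 0}. g j)"
    define F where "F = {j. f j \<noteq> 0} \<union> {j. g j \<noteq> 0}"
    have F: "finite F" "F \<subseteq> J" using f g by (auto simp: F_def)
    have "v = sum f F" using f F
      by (auto simp: F_def intro!: sum.mono_neutral_left)
    moreover have "v = sum g F" using g F
      by (auto simp: F_def intro!: sum.mono_neutral_left)
    ultimately have 0: "(\<Sum>j\<in>F. f j - g j) = 0" by (simp only: sum_subtractf diff_self)
    have "f j - g j \<in> V j" if "j \<in> F" for j
    proof -
      have "j \<in> J" using that F by blast
      then show ?thesis using f g sub subspace_diff by blast
    qed
    from indep[of F "\<lambda>j. f j - g j", OF F this 0]
    have eq: "f j = g j" if "j \<in> F" for j using that by simp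
    have "f j = g j" for j
    proof (cases "j \<in> F")
      case False
      then have "f j = 0" "g j = 0" by (simp_all add: F_def)
      then show ?thesis by simp
    qed (rule eq)
    then show "f = g" by blast
  qed
qed

text \<open>Extending \<open>{v}\<close> to a basis of \<open>S\<close> gives a set of cardinality
  1, so \<open>v\<close> alone spans \<open>S\<close>. This turns "meets a root space" into
  "contains it".\<close>

lemma (in vector_space) dim_one_subset:
  assumes "subspace S" "dim S = 1" "subspace T" "v \<in> S" "v \<in> T" "v \<noteq> 0"
  shows "S \<subseteq> T"
proof -
  have "independent {v}" using assms by simp
  then obtain B where B: "{v} \<subseteq> B" "B \<subseteq> S" "independent B" "S \<subseteq> span B"
    using maximal_independent_subset_extend[of "{v}" S] assms by auto
  then have "card B = 1" using basis_card_eq_dim[of B S] assms by simp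
  then have "B = {v}" using B(1) by (auto simp: card_1_singleton_iff)
  then have "S \<subseteq> span {v}" using B by simp
  also have "\<dots> \<subseteq> T" using assms by (intro span_minimal) auto
  finally show ?thesis .
qed

section \<open>Bracket calculus inside the carrier\<close>

context delta_jordan_lie
begin

text \<open>The laws of \<open>br\<close> are available only on \<open>L\<close>, so nearly every
  rewriting step has to discharge membership in the carrier.\<close>

lemma carrier_closed [simp]:
  "0 \<in> L" "x \<in> L \<Longrightarrow> y \<in> L \<Longrightarrow> x + y \<in> L" "x \<in> L \<Longrightarrow> scale c x \<in> L"
  "x \<in> L \<Longrightarrow> y \<in> L \<Longrightarrow> x - y \<in> L" "x \<in> L \<Longrightarrow> - x \<in> L" "x \<in> L \<Longrightarrow> y \<in> L \<Longrightarrow> br x y \<in> L"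
  using subspace_carrier br_closed
  by (auto simp: subspace_0 subspace_add subspace_scale subspace_diff subspace_neg)

lemma br_zero [simp]: "x \<in> L \<Longrightarrow> br 0 x = 0" "x \<in> L \<Longrightarrow> br x 0 = 0"
  using br_scale_left[of 0 x 0] br_scale_right[of x 0 0] by auto

lemma br_sum_right:
  assumes "x \<in> L" "\<And>j. j \<in> F \<Longrightarrow> f j \<in> L"
  shows "br x (sum f F) = (\<Sum>j\<in>F. br x (f j))"
  using assms(2)
proof (induction F rule: infinite_finite_induct)
  case (insert j F)
  then show ?case using assms(1) subspace_sum[OF subspace_carrier, of F f]
    by (simp add: br_add_right)
qed (use assms(1) in auto)

text \<open>Reduction to generators, one induction per argument. Each induction carries membership
  in \<open>L\<close> along, because bilinearity is only assumed there.\<close>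

lemma br_span:
  assumes "A \<subseteq> L" "B \<subseteq> L" "subspace S" "\<And>a b. a \<in> A \<Longrightarrow> b \<in> B \<Longrightarrow> br a b \<in> S"
    and "x \<in> span A" "y \<in> span B"
  shows "br x y \<in> S"
proof -
  have BL: "span B \<subseteq> L"
    using assms subspace_carrier span_minimal[of B L] by blast
  have 1: "y \<in> L \<and> br a y \<in> S" if "a \<in> A" for a
    using assms(6)
  proof (induction rule: span_induct_alt)
    case (step c b z)
    then show ?case using that assms by (auto simp: br_add_right br_scale_right subset_iff
        intro!: subspace_add subspace_scale)
  qed (use assms that in \<open>auto simp: subspace_0\<close>)
  have yL: "y \<in> L" using assms BL by auto
  have "x \<in> L \<and> br x y \<in> S" using assms(5)
  proof (induction rule: span_induct_alt)
    case (step c b z)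
    then show ?case using yL 1 assms by (auto simp: br_add_left br_scale_left subset_iff
        intro!: subspace_add subspace_scale)
  qed (use assms yL in \<open>auto simp: subspace_0\<close>)
  then show ?thesis by simp
qed

lemma restrict_ideal:
  assumes "is_ideal scale br L I"
  shows "delta_jordan_lie scale br \<delta> I"
proof
  have "I \<subseteq> L" using assms by (simp add: is_ideal_def)
  note L = subsetD[OF this]
  show "\<delta> = 1 \<or> \<delta> = - 1" by (rule delta)
  show "subspace I" using assms by (simp add: is_ideal_def)
  show "br x y \<in> I" if "x \<in> I" "y \<in> I" for x y
    using assms that L by (auto simp: is_ideal_def)
  show "br x y = - scale \<delta> (br y x)" if "x \<in> I" "y \<in> I" for x y
    using that L by (intro br_skew) auto
  show "br x (br y z) = scale \<delta> (br (br x y) z) + scale \<delta> (br y (br x z))"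
    if "x \<in> I" "y \<in> I" "z \<in> I" for x y z
    using that L by (intro br_jacobi) auto
qed (use assms in \<open>auto simp: is_ideal_def subset_iff br_add_left br_add_right br_scale_left
    br_scale_right\<close>)

end

section \<open>Homogeneous components\<close>

text \<open>For \<delta> = 1 in characteristic 0 the axioms are those of a Lie algebra; the other
  sign is settled separately at the end.\<close>

locale split_lie = delta_jordan_lie scale br 1 L
  for scale :: "'k::field_char_0 \<Rightarrow> 'v::ab_group_add \<Rightarrow> 'v" and br L +
  fixes H :: "'v set"
  assumes cartan: "splitting_cartan scale br 1 L H"
begin

abbreviation Rts ("\<Lambda>") where "\<Lambda> \<equiv> roots scale br L H"
abbreviation RS where "RS \<equiv> root_space scale br L H"

lemma H_sub: "subspace H" "H \<subseteq> L" and H_abelian: "x \<in> H \<Longrightarrow> y \<in> H \<Longrightarrow> br x y = 0"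
  using cartan by (auto simp: splitting_cartan_def maximal_abelian_subalgebra_def abelian_subalgebra_def)

lemma H_L [simp]: "h \<in> H \<Longrightarrow> h \<in> L" using H_sub by auto

lemma skew: "x \<in> L \<Longrightarrow> y \<in> L \<Longrightarrow> br x y = - br y x"
  using br_skew[of x y] by simp

lemma jacobi: "x \<in> L \<Longrightarrow> y \<in> L \<Longrightarrow> z \<in> L \<Longrightarrow> br x (br y z) = br (br x y) z + br y (br x z)"
  using br_jacobi[of x y z] by simp

lemma subspace_RS: "subspace (RS \<alpha>)"
  by (rule subspaceI) (auto simp: root_space_def br_add_right br_scale_right scale_right_distrib mult.commute)

lemma RS_L: "x \<in> RS \<alpha> \<Longrightarrow> x \<in> L"
  by (simp add: root_space_def)

lemma RS_H: "x \<in> RS \<alpha> \<Longrightarrow> h \<in> H \<Longrightarrow> br h x = scale (\<alpha> h) x"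
  by (simp add: root_space_def)

lemma roots_dual: "\<alpha> \<in> \<Lambda> \<Longrightarrow> \<alpha> \<in> dual scale H"
  by (simp add: roots_def)

lemma dual_zero: "(\<lambda>_. 0) \<in> dual scale H"
  by (simp add: dual_def)

lemma dual_separated:
  assumes "\<alpha> \<in> dual scale H" "\<beta> \<in> dual scale H" "\<alpha> \<noteq> \<beta>"
  obtains h where "h \<in> H" "\<alpha> h \<noteq> \<beta> h"
proof -
  obtain h where "\<alpha> h \<noteq> \<beta> h" using assms by blast
  moreover from this have "h \<in> H" using assms by (auto simp: dual_def)
  ultimately show ?thesis using that by blast
qed

text \<open>The coordinates of \<open>root_decomposition\<close> with its conditional on the index
  split up: index 0 carries the part in \<open>H\<close>.\<close>

definition decomposes :: "'v \<Rightarrow> (('v \<Rightarrow> 'k) \<Rightarrow> 'v) \<Rightarrow> bool" where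
  "decomposes v f \<longleftrightarrow> f (\<lambda>_. 0) \<in> H \<and> (\<forall>\<alpha>\<in>\<Lambda>. f \<alpha> \<in> RS \<alpha>) \<and> (\<forall>\<alpha>. \<alpha> \<notin> insert (\<lambda>_. 0) \<Lambda> \<longrightarrow> f \<alpha> = 0) \<and>
     finite {\<alpha>. f \<alpha> \<noteq> 0} \<and> v = (\<Sum>\<alpha>\<in>{\<alpha>. f \<alpha> \<noteq> 0}. f \<alpha>)"

lemma zero_notin_roots: "(\<lambda>_. 0) \<notin> \<Lambda>"
  by (simp add: roots_def)

lemma ex1_decomposes:
  assumes "v \<in> L" shows "\<exists>!f. decomposes v f"
proof -
  have "(\<forall>j\<in>insert (\<lambda>_. 0) \<Lambda>. f j \<in> (if j = (\<lambda>_. 0) then H else RS j)) \<longleftrightarrow>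
      f (\<lambda>_. 0) \<in> H \<and> (\<forall>\<alpha>\<in>\<Lambda>. f \<alpha> \<in> RS \<alpha>)" for f
    using zero_notin_roots by auto
  then show ?thesis
    using cartan assms
    unfolding splitting_cartan_def root_decomposition_def direct_sum_def decomposes_def by auto
qed

definition component :: "'v \<Rightarrow> ('v \<Rightarrow> 'k) \<Rightarrow> 'v" where
  "component v = (THE f. decomposes v f)"

lemma decomposes_component: "v \<in> L \<Longrightarrow> decomposes v (component v)"
  unfolding component_def by (rule theI'[OF ex1_decomposes])

text \<open>Any finite \<open>F\<close> containing the support is allowed, so the exact support of
  \<open>f\<close>, which may shrink through cancellation, never has to be computed.\<close>

lemma component_eqI:
  assumes "v \<in> L" "f (\<lambda>_. 0) \<in> H" "\<And>\<alpha>. \<alpha> \<in> \<Lambda> \<Longrightarrow> f \<alpha> \<in> RS \<alpha>" "\<And>\<alpha>. \<alpha> \<notin> insert (\<lambda>_. 0) \<Lambda> \<Longrightarrow> f \<alpha> = 0"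
    "finite F" "{\<alpha>. f \<alpha> \<noteq> 0} \<subseteq> F" "v = sum f F"
  shows "component v = f"
proof -
  have "sum f F = (\<Sum>\<alpha>\<in>{\<alpha>. f \<alpha> \<noteq> 0}. f \<alpha>)"
    by (rule sum.mono_neutral_right) (use assms in auto)
  then have "decomposes v f"
    unfolding decomposes_def using assms finite_subset by auto
  then show ?thesis using ex1_decomposes[OF assms(1)] decomposes_component[OF assms(1)] by auto
qed

lemma
  assumes "v \<in> L"
  shows component_H: "component v (\<lambda>_. 0) \<in> H"
    and component_RS: "\<alpha> \<in> \<Lambda> \<Longrightarrow> component v \<alpha> \<in> RS \<alpha>"
    and component_outside: "\<alpha> \<notin> insert (\<lambda>_. 0) \<Lambda> \<Longrightarrow> component v \<alpha> = 0"
    and finite_component: "finite {\<alpha>. component v \<alpha> \<noteq> 0}"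
    and sum_component: "v = (\<Sum>\<alpha>\<in>{\<alpha>. component v \<alpha> \<noteq> 0}. component v \<alpha>)"
  using decomposes_component[OF assms] unfolding decomposes_def by auto

lemma sum_component_superset:
  assumes "v \<in> L" "finite F" "{\<alpha>. component v \<alpha> \<noteq> 0} \<subseteq> F"
  shows "v = sum (component v) F"
proof -
  have "sum (component v) F = (\<Sum>\<alpha>\<in>{\<alpha>. component v \<alpha> \<noteq> 0}. component v \<alpha>)"
    by (rule sum.mono_neutral_right) (use assms in auto)
  then show ?thesis using sum_component[OF assms(1)] by simp
qed

lemma component_L: "v \<in> L \<Longrightarrow> component v \<alpha> \<in> L"
  by (metis RS_L carrier_closed(1) component_H component_RS component_outside H_L insert_iff)

text \<open>Every summand is an eigenspace of bracketing with \<open>h\<close>, the summand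
  \<open>H\<close> with eigenvalue 0 because it is abelian. The rescaled family is therefore a
  decomposition of \<open>br h v\<close>, and uniqueness identifies it.\<close>

lemma component_br:
  assumes "v \<in> L" "h \<in> H"
  shows "component (br h v) = (\<lambda>\<alpha>. scale (\<alpha> h) (component v \<alpha>))"
proof (rule component_eqI[OF _ _ _ _ finite_component[OF assms(1)]])
  show "br h v \<in> L" using assms by simp
  show "scale 0 (component v (\<lambda>_. 0)) \<in> H" using H_sub by (simp add: subspace_0)
  show "scale (\<alpha> h) (component v \<alpha>) \<in> RS \<alpha>" if "\<alpha> \<in> \<Lambda>" for \<alpha>
    using component_RS[OF assms(1) that] by (intro subspace_scale subspace_RS)
  show "scale (\<alpha> h) (component v \<alpha>) = 0" if "\<alpha> \<notin> insert (\<lambda>_. 0) \<Lambda>" for \<alpha>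
    using component_outside[OF assms(1) that] by simp
  show "{\<alpha>. scale (\<alpha> h) (component v \<alpha>) \<noteq> 0} \<subseteq> {\<alpha>. component v \<alpha> \<noteq> 0}" by auto
  have "br h (component v \<alpha>) = scale (\<alpha> h) (component v \<alpha>)" for \<alpha>
  proof (cases "\<alpha> \<in> insert (\<lambda>_. 0) \<Lambda>")
    case True
    then show ?thesis
      using H_abelian[OF assms(2) component_H] RS_H[OF component_RS assms(2)] assms by auto
  next
    case False
    then show ?thesis using component_outside assms by simp
  qed
  then show "br h v = (\<Sum>\<alpha>\<in>{\<alpha>. component v \<alpha> \<noteq> 0}. scale (\<alpha> h) (component v \<alpha>))"
    using assms by (subst sum_component[OF assms(1)], subst br_sum_right) (auto simp: component_L)
qed

lemma component_add:
  assumes "v \<in> L" "w \<in> L"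
  shows "component (v + w) = (\<lambda>\<alpha>. component v \<alpha> + component w \<alpha>)"
proof (rule component_eqI[where F = "{\<alpha>. component v \<alpha> \<noteq> 0} \<union> {\<alpha>. component w \<alpha> \<noteq> 0}"])
  let ?F = "{\<alpha>. component v \<alpha> \<noteq> 0} \<union> {\<alpha>. component w \<alpha> \<noteq> 0}"
  show F: "finite ?F" using assms finite_component by simp
  show "v + w = (\<Sum>\<alpha>\<in>?F. component v \<alpha> + component w \<alpha>)"
    using sum_component_superset[of v ?F] sum_component_superset[of w ?F] assms F
    by (simp add: sum.distrib)
qed (use assms in \<open>auto simp: component_outside component_H component_RS
    intro!: subspace_add subspace_RS H_sub\<close>)

lemma component_scale:
  assumes "v \<in> L"
  shows "component (scale c v) = (\<lambda>\<alpha>. scale c (component v \<alpha>))"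
proof (rule component_eqI[OF _ _ _ _ finite_component[OF assms(1)]])
  show "scale c v = (\<Sum>\<alpha>\<in>{\<alpha>. component v \<alpha> \<noteq> 0}. scale c (component v \<alpha>))"
    using sum_component[OF assms] by (simp add: scale_sum_right[symmetric])
qed (use assms in \<open>auto simp: component_outside component_H component_RS
    intro!: subspace_scale subspace_RS H_sub\<close>)

lemma component_in_H:
  assumes "v \<in> H" shows "component v = (\<lambda>_. 0)((\<lambda>_. 0) := v)"
  by (rule component_eqI[where F = "{\<lambda>_. 0}"])
    (use assms zero_notin_roots in \<open>auto simp: subspace_0 subspace_RS\<close>)

lemma component_in_RS:
  assumes "v \<in> RS \<alpha>" "\<alpha> \<in> \<Lambda>" shows "component v = (\<lambda>_. 0)(\<alpha> := v)"
  by (rule component_eqI[where F = "{\<alpha>}"])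
    (use assms zero_notin_roots in \<open>auto simp: subspace_0 subspace_RS RS_L H_sub\<close>)

lemma component_support_dual:
  "v \<in> L \<Longrightarrow> component v \<alpha> \<noteq> 0 \<Longrightarrow> \<alpha> \<in> dual scale H"
  using component_outside[of v \<alpha>] roots_dual[of \<alpha>] dual_zero by blast

text \<open>\<open>H\<close> is its own centralizer: a nonzero component at \<alpha> \<noteq> 0
  would be multiplied by a nonzero \<alpha>(h) for a suitable h.\<close>

lemma commutes_H_imp_H:
  assumes "v \<in> L" "\<And>h. h \<in> H \<Longrightarrow> br h v = 0" shows "v \<in> H"
proof -
  have "component v \<alpha> = 0" if nonzero: "\<alpha> \<noteq> (\<lambda>_. 0)" for \<alpha>
  proof (rule ccontr)
    assume nz: "component v \<alpha> \<noteq> 0"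
    obtain h where h: "h \<in> H" "\<alpha> h \<noteq> 0"
      using dual_separated[OF component_support_dual[OF assms(1) nz] dual_zero nonzero] .
    have "scale (\<alpha> h) (component v \<alpha>) = component (br h v) \<alpha>" using component_br[OF assms(1) h(1)] by simp
    also have "\<dots> = component (scale 0 v) \<alpha>" using assms(2) h by simp
    also have "\<dots> = 0" using component_scale[OF assms(1), of 0] by simp
    finally show False using h nz by simp
  qed
  then have "v = sum (component v) {\<lambda>_. 0}"
    using assms by (intro sum_component_superset) auto
  then show ?thesis using component_H[OF assms(1)] by simp
qed

text \<open>With \<open>H\<close> as the weight space of 0, the inclusion of
  [L_\<alpha>, L_-\<alpha>] in \<open>H\<close> becomes an instance of addition of weights.\<close>

lemma RS_zero: "RS (\<lambda>_. 0) = H"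
  using commutes_H_imp_H H_abelian by (auto simp: root_space_def)

text \<open>Subtracting the eigenvalue of one component removes that component while rescaling the
  others, so the support can be cut down to a single root.\<close>

lemma component_in_stable_subspace:
  assumes "subspace S" "S \<subseteq> L" "\<And>h x. h \<in> H \<Longrightarrow> x \<in> S \<Longrightarrow> br h x \<in> S" "v \<in> S"
  shows "component v \<alpha> \<in> S"
  using assms(4)
proof (induction "card {\<alpha>. component v \<alpha> \<noteq> 0}" arbitrary: v rule: less_induct)
  case less
  have v: "v \<in> L" using less assms by auto
  consider "component v \<alpha> = 0" | "{\<beta>. component v \<beta> \<noteq> 0} \<subseteq> {\<alpha>}" |
    \<beta> where "component v \<alpha> \<noteq> 0" "component v \<beta> \<noteq> 0" "\<beta> \<noteq> \<alpha>" by blast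
  then show ?case
  proof cases
    case 1
    then show ?thesis using assms by (simp add: subspace_0)
  next
    case 2
    then show ?thesis using sum_component_superset[OF v _ 2] less by simp
  next
    case (3 \<beta>)
    obtain h where h: "h \<in> H" "\<beta> h \<noteq> \<alpha> h"
      using dual_separated component_support_dual[OF v] 3 by metis
    define w where "w = br h v + scale (- \<beta> h) v"
    have wS: "w \<in> S" using assms less h unfolding w_def by (intro subspace_add subspace_scale) auto
    have cw: "component w \<gamma> = scale (\<gamma> h - \<beta> h) (component v \<gamma>)" for \<gamma>
      unfolding w_def using v h
      by (simp add: component_add component_br component_scale scale_left_distrib[symmetric]
          del: scale_minus_left)
    have "{\<gamma>. component w \<gamma> \<noteq> 0} \<subset> {\<gamma>. component v \<gamma> \<noteq> 0}"
      using 3 by (auto simp: cw)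
    then have "card {\<gamma>. component w \<gamma> \<noteq> 0} < card {\<gamma>. component v \<gamma> \<noteq> 0}"
      by (intro psubset_card_mono finite_component v)
    from less(1)[OF this wS] have "scale (1 / (\<alpha> h - \<beta> h)) (component w \<alpha>) \<in> S"
      using assms by (intro subspace_scale)
    then show ?thesis using h by (simp add: cw)
  qed
qed


section \<open>Weights of brackets of root vectors\<close>

abbreviation neg :: "('v \<Rightarrow> 'k) \<Rightarrow> 'v \<Rightarrow> 'k" where "neg \<alpha> \<equiv> \<lambda>h. - \<alpha> h"
abbreviation plus_root :: "('v \<Rightarrow> 'k) \<Rightarrow> ('v \<Rightarrow> 'k) \<Rightarrow> 'v \<Rightarrow> 'k" where
  "plus_root \<alpha> \<beta> \<equiv> \<lambda>h. \<alpha> h + \<beta> h"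

lemma RS_br:
  assumes "x \<in> RS \<alpha>" "y \<in> RS \<beta>"
  shows "br x y \<in> RS (plus_root \<alpha> \<beta>)"
proof -
  have "br h (br x y) = scale (\<alpha> h + \<beta> h) (br x y)" if "h \<in> H" for h
  proof -
    have "br h (br x y) = br (br h x) y + br x (br h y)"
      using assms[THEN RS_L] that by (intro jacobi) auto
    then show ?thesis
      using assms[THEN RS_L] assms[THEN RS_H, OF that] by (simp add: br_scale_left br_scale_right scale_left_distrib)
  qed
  then show ?thesis using assms[THEN RS_L] by (simp add: root_space_def)
qed

lemma RS_br_neg:
  assumes "x \<in> RS \<alpha>" "y \<in> RS (neg \<alpha>)"
  shows "br x y \<in> H"
  using RS_br[OF assms] RS_zero by simp

lemma dual_plus: "\<alpha> \<in> dual scale H \<Longrightarrow> \<beta> \<in> dual scale H \<Longrightarrow> plus_root \<alpha> \<beta> \<in> dual scale H"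
  by (auto simp: dual_def distrib_left)

lemma rootI: "\<alpha> \<in> dual scale H \<Longrightarrow> \<alpha> \<noteq> (\<lambda>_. 0) \<Longrightarrow> x \<in> RS \<alpha> \<Longrightarrow> x \<noteq> 0 \<Longrightarrow> \<alpha> \<in> \<Lambda>"
  by (auto simp: roots_def)

text \<open>A nonzero bracket has weight \<alpha> + \<beta> and thereby witnesses that this sum is a
  root, unless the sum is 0. Later computations with two root vectors split along these
  cases.\<close>

lemma RS_br_cases:
  assumes "\<alpha> \<in> \<Lambda>" "\<beta> \<in> \<Lambda>" "x \<in> RS \<alpha>" "y \<in> RS \<beta>"
  obtains "br x y = 0" | "\<beta> = neg \<alpha>" | "plus_root \<alpha> \<beta> \<in> \<Lambda>"
proof (cases "br x y = 0 \<or> plus_root \<alpha> \<beta> = (\<lambda>_. 0)")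
  case True
  then show ?thesis using that by (auto simp: fun_eq_iff add_eq_0_iff)
next
  case False
  then have "plus_root \<alpha> \<beta> \<in> \<Lambda>"
    using rootI[OF dual_plus _ RS_br] assms roots_dual by blast
  then show ?thesis using that by blast
qed

lemma root_space_nonzero:
  assumes "\<alpha> \<in> \<Lambda>" obtains x where "x \<in> RS \<alpha>" "x \<noteq> 0"
  using assms subspace_0[OF subspace_RS[of \<alpha>]] that by (auto simp: roots_def)

lemma span_L: "A \<subseteq> L \<Longrightarrow> span A \<subseteq> L"
  by (rule span_minimal) (use subspace_carrier in auto)

lemma L_eq_span: "L = span (H \<union> (\<Union>\<alpha>\<in>\<Lambda>. RS \<alpha>))"
proof
  show "L \<subseteq> span (H \<union> (\<Union>\<alpha>\<in>\<Lambda>. RS \<alpha>))"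
  proof
    fix v assume v: "v \<in> L"
    have "component v \<alpha> \<in> span (H \<union> (\<Union>\<alpha>\<in>\<Lambda>. RS \<alpha>))" if "component v \<alpha> \<noteq> 0" for \<alpha>
      using component_H[OF v] component_RS[OF v] component_outside[OF v, of \<alpha>] that
      by (intro span_base) auto
    then show "v \<in> span (H \<union> (\<Union>\<alpha>\<in>\<Lambda>. RS \<alpha>))"
      by (subst sum_component[OF v]) (auto intro: span_sum)
  qed
  show "span (H \<union> (\<Union>\<alpha>\<in>\<Lambda>. RS \<alpha>)) \<subseteq> L"
    using H_sub RS_L by (intro span_L) auto
qed

section \<open>Classes of connected roots\<close>

text \<open>Named after the classical case, where [L_\<alpha>, L_-\<alpha>] is the line through the
  coroot of \<alpha>. These are the bare brackets without normalization; the span is taken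
  afterwards.\<close>

definition coroots :: "('v \<Rightarrow> 'k) set \<Rightarrow> 'v set" where
  "coroots C = {br x y | x y \<alpha>. \<alpha> \<in> C \<and> x \<in> RS \<alpha> \<and> y \<in> RS (neg \<alpha>)}"

definition class_gens :: "('v \<Rightarrow> 'k) set \<Rightarrow> 'v set" where
  "class_gens C = coroots C \<union> (\<Union>\<alpha>\<in>C. RS \<alpha>)"

abbreviation class_cartan where "class_cartan C \<equiv> span (coroots C)"
abbreviation class_ideal where "class_ideal C \<equiv> span (class_gens C)"

lemma coroots_H: "coroots C \<subseteq> H"
  unfolding coroots_def using RS_br_neg by auto

lemma class_gens_L: "class_gens C \<subseteq> L"
  unfolding class_gens_def using coroots_H H_sub RS_L by blast

lemma class_cartan_H: "class_cartan C \<subseteq> H"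
  by (intro span_minimal coroots_H H_sub)

lemma class_cartan_ideal: "class_cartan C \<subseteq> class_ideal C"
  by (rule span_mono) (simp add: class_gens_def)

lemma coroots_class_ideal: "coroots C \<subseteq> class_ideal C"
  using span_superset[of "class_gens C"] by (simp add: class_gens_def)

lemma class_ideal_L: "class_ideal C \<subseteq> L"
  by (intro span_L class_gens_L)

lemma RS_class_ideal: "\<alpha> \<in> C \<Longrightarrow> RS \<alpha> \<subseteq> class_ideal C"
  using span_superset[of "class_gens C"] by (auto simp: class_gens_def)

text \<open>The generators are homogeneous and both conditions on components are linear, so taking
  the span adds nothing to the \<open>H\<close> part beyond the coroots and reaches no root outside
  \<open>C\<close>.\<close>

lemma component_class_ideal:
  assumes "C \<subseteq> \<Lambda>" "v \<in> class_ideal C"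
  shows "component v (\<lambda>_. 0) \<in> class_cartan C" "\<alpha> \<notin> insert (\<lambda>_. 0) C \<Longrightarrow> component v \<alpha> = 0"
proof -
  have z: "component 0 = (\<lambda>_. 0)" using component_scale[of 0 0] by simp
  have g: "component x (\<lambda>_. 0) \<in> class_cartan C \<and> (\<forall>\<alpha>. \<alpha> \<notin> insert (\<lambda>_. 0) C \<longrightarrow> component x \<alpha> = 0)"
    if xg: "x \<in> class_gens C" for x
  proof (cases "x \<in> coroots C")
    case True
    then have "x \<in> H" using coroots_H by auto
    then show ?thesis using True by (simp add: component_in_H span_base)
  next
    case False
    then obtain \<beta> where "\<beta> \<in> C" "x \<in> RS \<beta>" using xg by (auto simp: class_gens_def)
    then show ?thesis using assms zero_notin_roots by (subst (1 2) component_in_RS) (auto simp: span_zero)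
  qed
  have "v \<in> L \<and> component v (\<lambda>_. 0) \<in> class_cartan C \<and>
    (\<forall>\<alpha>. \<alpha> \<notin> insert (\<lambda>_. 0) C \<longrightarrow> component v \<alpha> = 0)"
    using assms(2)
  proof (induction rule: span_induct_alt)
    case base
    then show ?case by (simp add: z span_zero)
  next
    case (step c x y)
    then have xL: "x \<in> L" using class_gens_L by auto
    then show ?case using step g[OF step(1)]
      by (auto simp: component_add component_scale intro!: span_add span_scale)
  qed
  then show "component v (\<lambda>_. 0) \<in> class_cartan C"
    "\<alpha> \<notin> insert (\<lambda>_. 0) C \<Longrightarrow> component v \<alpha> = 0" by auto
qed

lemma class_ideal_inter_H:
  assumes "C \<subseteq> \<Lambda>" shows "class_ideal C \<inter> H = class_cartan C"
proof
  show "class_ideal C \<inter> H \<subseteq> class_cartan C"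
    using component_class_ideal(1)[OF assms] component_in_H by fastforce
  show "class_cartan C \<subseteq> class_ideal C \<inter> H"
    using class_cartan_H class_cartan_ideal by auto
qed

text \<open>One link of a connection, with the sign change allowed at every link instead of only at
  the end. Classes are built from single links because symmetry and closure can be checked link by
  link; explicit chains are recovered only for the final statement.\<close>

definition root_step :: "('v \<Rightarrow> 'k) \<Rightarrow> ('v \<Rightarrow> 'k) \<Rightarrow> bool" where
  "root_step \<alpha> \<beta> \<longleftrightarrow> \<alpha> \<in> \<Lambda> \<and> \<beta> \<in> \<Lambda> \<and> (\<beta> = neg \<alpha> \<or> (\<exists>\<eta>\<in>\<Lambda>. \<beta> = plus_root \<alpha> \<eta>))"

definition root_class :: "('v \<Rightarrow> 'k) \<Rightarrow> ('v \<Rightarrow> 'k) set" where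
  "root_class \<alpha> = {\<beta>. root_step\<^sup>*\<^sup>* \<alpha> \<beta>}"

lemma root_class_self: "\<alpha> \<in> root_class \<alpha>"
  by (simp add: root_class_def)

lemma root_class_roots: "\<alpha> \<in> \<Lambda> \<Longrightarrow> root_class \<alpha> \<subseteq> \<Lambda>"
proof -
  assume "\<alpha> \<in> \<Lambda>"
  have "\<beta> \<in> \<Lambda>" if "root_step\<^sup>*\<^sup>* \<alpha> \<beta>" for \<beta>
    using that \<open>\<alpha> \<in> \<Lambda>\<close> by (induction) (auto simp: root_step_def)
  then show ?thesis by (auto simp: root_class_def)
qed

lemma root_class_step: "\<beta> \<in> root_class \<alpha> \<Longrightarrow> root_step \<beta> \<gamma> \<Longrightarrow> \<gamma> \<in> root_class \<alpha>"
  by (auto simp: root_class_def)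

end

section \<open>Class ideals and their orthogonality\<close>

locale perfect_split_lie = split_lie scale br L H
  for scale :: "'k::field_char_0 \<Rightarrow> 'v::ab_group_add \<Rightarrow> 'v" and br L H +
  assumes symmetric: "symmetric_roots \<Lambda>"
    and multiplicative: "root_multiplicative scale br L H"
    and centerless: "center br L = {0}"
    and perfect: "bracket_space scale br L L = L"
    and dim_one: "\<alpha> \<in> \<Lambda> \<Longrightarrow> dim (RS \<alpha>) = 1"
begin

lemma neg_root: "\<alpha> \<in> \<Lambda> \<Longrightarrow> neg \<alpha> \<in> \<Lambda>"
  using symmetric by (auto simp: symmetric_roots_def)

text \<open>A link that adds \<eta> is undone by adding -\<eta>, which is a root by symmetry of the
  root system.\<close>

lemma root_step_sym: "root_step \<alpha> \<beta> \<Longrightarrow> root_step \<beta> \<alpha>"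
proof -
  assume s: "root_step \<alpha> \<beta>"
  have "\<alpha> = neg \<beta>" if "\<beta> = neg \<alpha>" using that by simp
  moreover have "\<alpha> = plus_root \<beta> (neg \<eta>)" if "\<beta> = plus_root \<alpha> \<eta>" for \<eta> using that by simp
  ultimately show ?thesis using s neg_root unfolding root_step_def by metis
qed

lemma root_class_eq: "\<beta> \<in> root_class \<alpha> \<Longrightarrow> root_class \<beta> = root_class \<alpha>"
proof -
  assume "\<beta> \<in> root_class \<alpha>"
  then have "root_step\<^sup>*\<^sup>* \<alpha> \<beta>" by (simp add: root_class_def)
  moreover have "symp root_step" by (rule sympI) (rule root_step_sym)
  ultimately have "root_step\<^sup>*\<^sup>* \<alpha> \<beta>" "root_step\<^sup>*\<^sup>* \<beta> \<alpha>"
    using sympD[OF symp_rtranclp] by auto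
  then show ?thesis unfolding root_class_def by (auto intro: rtranclp_trans)
qed

lemma root_class_neg:
  assumes "\<alpha> \<in> \<Lambda>" "\<beta> \<in> root_class \<alpha>"
  shows "neg \<beta> \<in> root_class \<alpha>"
proof -
  have "\<beta> \<in> \<Lambda>" using assms root_class_roots by blast
  then have "root_step \<beta> (neg \<beta>)" using neg_root[of \<beta>] unfolding root_step_def by blast
  then show ?thesis by (rule root_class_step[OF assms(2)])
qed

lemma root_class_plus:
  assumes "\<alpha> \<in> \<Lambda>" "\<beta> \<in> root_class \<alpha>" "\<gamma> \<in> \<Lambda>" "plus_root \<beta> \<gamma> \<in> \<Lambda>"
  shows "plus_root \<beta> \<gamma> \<in> root_class \<alpha>"
proof -
  have "\<beta> \<in> \<Lambda>" using assms root_class_roots by blast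
  then have "root_step \<beta> (plus_root \<beta> \<gamma>)" using assms unfolding root_step_def by blast
  then show ?thesis by (rule root_class_step[OF assms(2)])
qed

text \<open>The sum is reached from \<gamma> by adding \<beta>, so \<gamma> shares the class of the
  sum, which is the class of \<beta>. This is what separates different classes.\<close>

lemma root_class_plus_right:
  assumes "\<alpha> \<in> \<Lambda>" "\<beta> \<in> root_class \<alpha>" "\<gamma> \<in> \<Lambda>" "plus_root \<beta> \<gamma> \<in> \<Lambda>"
  shows "\<gamma> \<in> root_class \<alpha>"
proof -
  have "plus_root \<beta> \<gamma> = plus_root \<gamma> \<beta>" by (simp add: add.commute)
  then have "root_step \<gamma> (plus_root \<beta> \<gamma>)"
    using assms root_class_roots[of \<alpha>] unfolding root_step_def by blast
  then show ?thesis
    using root_class_step[OF root_class_plus[OF assms] root_step_sym] by blast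
qed

text \<open>Brackets of elements of \<open>H\<close> and of root vectors reach \<open>H\<close> only
  through coroots, apart from 0. Since such brackets span [L, L] = L, the coroots suffice in place
  of all of \<open>H\<close>.\<close>

lemma L_eq_class_gens: "L = class_ideal \<Lambda>"
proof
  let ?S = "class_ideal \<Lambda>" let ?G = "H \<union> (\<Union>\<alpha>\<in>\<Lambda>. RS \<alpha>)"
  have RS_S: "RS \<alpha> \<subseteq> ?S" if "\<alpha> \<in> \<Lambda>" for \<alpha> by (rule RS_class_ideal[OF that])
  have H_RS: "br x y \<in> ?S" if "x \<in> H" "\<alpha> \<in> \<Lambda>" "y \<in> RS \<alpha>" for x y \<alpha>
    using RS_H[OF that(3,1)] RS_S that span_scale by (metis subsetD)
  have gen: "br x y \<in> ?S" if x: "x \<in> ?G" and y: "y \<in> ?G" for x y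
  proof (cases "x \<in> H"; cases "y \<in> H")
    assume "x \<in> H" "y \<in> H"
    then show ?thesis using H_abelian by (simp add: span_zero)
  next
    assume "x \<in> H" "y \<notin> H"
    then show ?thesis using y H_RS by auto
  next
    assume xy: "x \<notin> H" "y \<in> H"
    then have "br y x \<in> ?S" using x H_RS by auto
    moreover have "br x y = - br y x" using xy x RS_L by (intro skew) auto
    ultimately show ?thesis by (simp add: span_neg)
  next
    assume "x \<notin> H" "y \<notin> H"
    then obtain \<alpha> \<beta> where ab: "\<alpha> \<in> \<Lambda>" "\<beta> \<in> \<Lambda>" "x \<in> RS \<alpha>" "y \<in> RS \<beta>" using x y by auto
    then show ?thesis
    proof (cases rule: RS_br_cases)
      case 1
      then show ?thesis by (simp add: span_zero)
    next
      case 2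
      then have "br x y \<in> coroots \<Lambda>" unfolding coroots_def using ab by blast
      then show ?thesis by (intro span_base) (simp add: class_gens_def)
    next
      case 3
      then show ?thesis using RS_S RS_br[OF ab(3,4)] by blast
    qed
  qed
  have "br x y \<in> ?S" if "x \<in> L" "y \<in> L" for x y
    by (rule br_span[of ?G ?G, OF _ _ _ gen]) (use that L_eq_span H_sub RS_L in auto)
  then have "bracket_space scale br L L \<subseteq> ?S"
    unfolding bracket_space_def by (intro span_minimal) auto
  then show "L \<subseteq> ?S" using perfect by simp
qed (rule class_ideal_L)

lemma H_eq_class_cartan: "H = class_cartan \<Lambda>"
  using class_ideal_inter_H[of \<Lambda>] L_eq_class_gens H_sub by auto

text \<open>If root vectors from two classes had a nonzero bracket, their weights would sum to 0 or
  to a root, and either would put both weights in one class. Coroots are then handled by the Jacobi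
  identity.\<close>

lemma class_gens_orthogonal:
  assumes a: "\<alpha> \<in> \<Lambda>" "\<beta> \<in> \<Lambda>" "\<beta> \<notin> root_class \<alpha>"
    and x: "x \<in> class_gens (root_class \<alpha>)" and y: "y \<in> class_gens (root_class \<beta>)"
  shows "br x y = 0"
proof -
  have disj: "\<gamma> \<notin> root_class \<alpha>" if "\<gamma> \<in> root_class \<beta>" for \<gamma>
    using that a root_class_eq root_class_self by metis
  have RR: "br u v = 0" if "\<gamma> \<in> root_class \<alpha>" "\<eta> \<in> root_class \<beta>" "u \<in> RS \<gamma>" "v \<in> RS \<eta>" for \<gamma> \<eta> u v
  proof -
    have r: "\<gamma> \<in> \<Lambda>" "\<eta> \<in> \<Lambda>" using that root_class_roots a by auto
    show ?thesis using r that(3,4)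
    proof (cases rule: RS_br_cases)
      case 2
      then show ?thesis using root_class_neg[OF a(1) that(1)] disj[OF that(2)] by simp
    next
      case 3
      then show ?thesis using root_class_plus_right[OF a(1) that(1) r(2)] disj[OF that(2)] by simp
    qed
  qed
  have gL: "x \<in> L" "y \<in> L" using x y class_gens_L by auto
  consider "x \<in> coroots (root_class \<alpha>)" "y \<in> coroots (root_class \<beta>)"
    | \<eta> where "x \<in> coroots (root_class \<alpha>)" "\<eta> \<in> root_class \<beta>" "y \<in> RS \<eta>"
    | \<gamma> where "\<gamma> \<in> root_class \<alpha>" "x \<in> RS \<gamma>" "y \<in> coroots (root_class \<beta>)"
    | \<gamma> \<eta> where "\<gamma> \<in> root_class \<alpha>" "x \<in> RS \<gamma>" "\<eta> \<in> root_class \<beta>" "y \<in> RS \<eta>"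
    using x y unfolding class_gens_def by blast
  then show ?thesis
  proof cases
    case 1
    then show ?thesis using coroots_H H_abelian by blast
  next
    case (2 \<eta>)
    then obtain u v \<gamma> where uv: "x = br u v" "\<gamma> \<in> root_class \<alpha>" "u \<in> RS \<gamma>" "v \<in> RS (neg \<gamma>)"
      by (auto simp: coroots_def)
    \<comment> \<open>The class is closed under negation, so \<open>y\<close> commutes with both
      factors of the coroot and hence with their bracket.\<close>
    have "br u y = 0" "br v y = 0"
      using RR uv 2 root_class_neg[OF a(1)] by blast+
    moreover have uL: "u \<in> L" "v \<in> L" using uv RS_L by blast+
    ultimately have "br y u = 0" "br y v = 0" using skew[OF gL(2)] by simp_all
    then have "br y x = 0" using jacobi[OF gL(2) uL] uL by (simp add: uv(1))
    then show ?thesis using skew[OF gL] by simp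
  next
    case (3 \<gamma>)
    then obtain u v \<eta> where uv: "y = br u v" "\<eta> \<in> root_class \<beta>" "u \<in> RS \<eta>" "v \<in> RS (neg \<eta>)"
      by (auto simp: coroots_def)
    have "br x u = 0" "br x v = 0"
      using RR uv 3 root_class_neg[OF a(2)] by blast+
    moreover have uL: "u \<in> L" "v \<in> L" using uv RS_L by blast+
    ultimately show ?thesis using jacobi[OF gL(1) uL] by (simp add: uv(1))
  next
    case (4 \<gamma> \<eta>)
    then show ?thesis using RR by blast
  qed
qed

lemma class_ideal_orthogonal:
  assumes "\<alpha> \<in> \<Lambda>" "\<beta> \<in> \<Lambda>" "\<beta> \<notin> root_class \<alpha>"
    and "x \<in> class_ideal (root_class \<alpha>)" "y \<in> class_ideal (root_class \<beta>)"
  shows "br x y = 0"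
proof -
  have "br x y \<in> {0}"
    by (rule br_span[OF class_gens_L class_gens_L subspace_single_0 _ assms(4,5)])
      (simp add: class_gens_orthogonal[OF assms(1-3)])
  then show ?thesis by simp
qed

lemma class_gens_roots: "class_gens \<Lambda> = (\<Union>\<beta>\<in>\<Lambda>. class_gens (root_class \<beta>))"
proof -
  have "\<Lambda> = (\<Union>\<beta>\<in>\<Lambda>. root_class \<beta>)" using root_class_roots root_class_self by blast
  moreover have "class_gens (\<Union>\<beta>\<in>\<Lambda>. root_class \<beta>) = (\<Union>\<beta>\<in>\<Lambda>. class_gens (root_class \<beta>))"
    unfolding class_gens_def coroots_def by blast
  ultimately show ?thesis by simp
qed

text \<open>\<open>L\<close> is generated by the generators of all classes. Those of the same class
  stay inside by closure under negatives and root sums; those of other classes act by 0.\<close>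

lemma is_ideal_class_ideal:
  assumes a: "\<alpha> \<in> \<Lambda>"
  shows "is_ideal scale br L (class_ideal (root_class \<alpha>))"
proof -
  let ?C = "root_class \<alpha>" let ?S = "class_ideal ?C"
  have RS_S: "RS \<beta> \<subseteq> ?S" if "\<beta> \<in> ?C" for \<beta> by (rule RS_class_ideal[OF that])
  have H_RS: "br x y \<in> ?S" if "x \<in> H" "\<beta> \<in> ?C" "y \<in> RS \<beta>" for x y \<beta>
    using RS_H[OF that(3,1)] RS_S that span_scale by (metis subsetD)
  have inner: "br x y \<in> ?S" if x: "x \<in> class_gens ?C" and y: "y \<in> class_gens ?C" for x y
  proof -
    consider "x \<in> H" "y \<in> H" | \<beta> where "x \<in> H" "\<beta> \<in> ?C" "y \<in> RS \<beta>"
      | \<beta> where "y \<in> H" "\<beta> \<in> ?C" "x \<in> RS \<beta>"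
      | \<beta> \<gamma> where "\<beta> \<in> ?C" "\<gamma> \<in> ?C" "x \<in> RS \<beta>" "y \<in> RS \<gamma>"
      using x y coroots_H[of ?C] unfolding class_gens_def by blast
    then show ?thesis
    proof cases
      case 1
      then show ?thesis using H_abelian by (simp add: span_zero)
    next
      case 2
      then show ?thesis using H_RS by blast
    next
      case (3 \<beta>)
      then have "br y x \<in> ?S" using H_RS by auto
      moreover have "br x y = - br y x" using 3 RS_L by (intro skew) auto
      ultimately show ?thesis by (simp add: span_neg)
    next
      case (4 \<beta> \<gamma>)
      then have r: "\<beta> \<in> \<Lambda>" "\<gamma> \<in> \<Lambda>" using root_class_roots a by auto
      show ?thesis using r 4(3,4)
      proof (cases rule: RS_br_cases)
        case 1
        then show ?thesis by (simp add: span_zero)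
      next
        case 2
        then have "br x y \<in> coroots ?C" unfolding coroots_def using 4 by blast
        then show ?thesis by (intro span_base) (simp add: class_gens_def)
      next
        case 3
        then show ?thesis using RS_S RS_br[OF 4(3,4)] root_class_plus[OF a 4(1) r(2)] by blast
      qed
    qed
  qed
  have gen: "br x y \<in> ?S" if x: "x \<in> class_gens ?C" and y: "y \<in> class_gens \<Lambda>" for x y
  proof -
    obtain \<beta> where b: "\<beta> \<in> \<Lambda>" "y \<in> class_gens (root_class \<beta>)" using y class_gens_roots by auto
    show ?thesis
    proof (cases "\<beta> \<in> ?C")
      case True
      then show ?thesis using inner x b root_class_eq by metis
    next
      case False
      then show ?thesis using class_gens_orthogonal[OF a b(1) False x b(2)] by (simp add: span_zero)
    qed
  qed
  have "br x y \<in> ?S" if "x \<in> ?S" "y \<in> L" for x y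
    by (rule br_span[OF class_gens_L class_gens_L _ gen]) (use that L_eq_class_gens in auto)
  then show ?thesis using class_ideal_L unfolding is_ideal_def by auto
qed

section \<open>Root spaces inside ideals\<close>

lemma RS_subset:
  assumes "\<alpha> \<in> \<Lambda>" "subspace J" "x \<in> J" "x \<in> RS \<alpha>" "x \<noteq> 0"
  shows "RS \<alpha> \<subseteq> J"
  using dim_one_subset[OF subspace_RS dim_one] assms by blast

text \<open>An ideal without root spaces would, by homogeneity and one-dimensionality, lie in
  \<open>H\<close>. For \<open>v\<close> in it, [v, L_\<alpha>] would lie both in \<open>J\<close>
  and in L_\<alpha>, hence be 0, and \<open>v\<close> would be central.\<close>

lemma nonzero_ideal_contains_RS:
  assumes J: "is_ideal scale br L J" and nz: "J \<noteq> {0}"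
  shows "\<exists>\<alpha>\<in>\<Lambda>. RS \<alpha> \<subseteq> J"
proof (rule ccontr)
  assume "\<not> ?thesis"
  then have no: "\<not> RS \<alpha> \<subseteq> J" if "\<alpha> \<in> \<Lambda>" for \<alpha> using that by blast
  have id: "br x y \<in> J" if "x \<in> J" "y \<in> L" for x y
    using J that by (auto simp: is_ideal_def)
  have JL: "subspace J" "J \<subseteq> L" using J by (auto simp: is_ideal_def)
  have id': "br y x \<in> J" if "x \<in> J" "y \<in> L" for x y
    using id[OF that] skew[of y x] that JL by (auto simp: subspace_neg)
  have JH: "J \<subseteq> H"
  proof
    fix v assume v: "v \<in> J"
    then have vL: "v \<in> L" using JL by auto
    have "component v \<alpha> \<in> J" for \<alpha>
      using component_in_stable_subspace[OF JL id' v] by simp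
    then have "component v \<alpha> = 0" if "\<alpha> \<noteq> (\<lambda>_. 0)" for \<alpha>
      using no RS_subset[OF _ JL(1) _ component_RS[OF vL]] component_outside[OF vL, of \<alpha>] that by blast
    then have "v = sum (component v) {\<lambda>_. 0}"
      by (intro sum_component_superset[OF vL]) auto
    then show "v \<in> H" using component_H[OF vL] by simp
  qed
  obtain v where v: "v \<in> J" "v \<noteq> 0" using nz subspace_0[OF JL(1)] by blast
  have "br v x = 0" if xg: "x \<in> H \<union> (\<Union>\<alpha>\<in>\<Lambda>. RS \<alpha>)" for x
  proof (cases "x \<in> H")
    case True
    then show ?thesis using H_abelian v JH by blast
  next
    case False
    then obtain \<alpha> where a: "\<alpha> \<in> \<Lambda>" "x \<in> RS \<alpha>" using xg by blast
    have "br v x \<in> J" using id v a RS_L by auto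
    moreover have "br v x \<in> RS \<alpha>" using RS_H[OF a(2), of v] v JH a subspace_scale[OF subspace_RS] by auto
    ultimately show ?thesis using RS_subset[OF a(1) JL(1)] no[OF a(1)] by blast
  qed
  then have "br v x = 0" if "x \<in> L" for x
  proof -
    have "br v x \<in> {0}"
    proof (rule br_span[where A = "{v}" and B = "H \<union> (\<Union>\<alpha>\<in>\<Lambda>. RS \<alpha>)"])
      show "H \<union> (\<Union>\<alpha>\<in>\<Lambda>. RS \<alpha>) \<subseteq> L" using H_sub RS_L by blast
      show "x \<in> span (H \<union> (\<Union>\<alpha>\<in>\<Lambda>. RS \<alpha>))" using that L_eq_span by simp
      show "v \<in> span {v}" by (simp add: span_base)
      show "{v} \<subseteq> L" using v JL by blast
      show "br a b \<in> {0}" if "a \<in> {v}" "b \<in> H \<union> (\<Union>\<alpha>\<in>\<Lambda>. RS \<alpha>)" for a b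
        using that \<open>\<And>x. x \<in> H \<union> (\<Union>\<alpha>\<in>\<Lambda>. RS \<alpha>) \<Longrightarrow> br v x = 0\<close> by blast
    qed (rule subspace_single_0)
    then show ?thesis by simp
  qed
  then show False using centerless v JL by (auto simp: center_def)
qed

section \<open>Roots as functionals on the coroots\<close>

lemma coroots_roots: "coroots \<Lambda> = (\<Union>\<beta>\<in>\<Lambda>. coroots (root_class \<beta>))"
proof -
  have "\<Lambda> = (\<Union>\<beta>\<in>\<Lambda>. root_class \<beta>)" using root_class_roots root_class_self by blast
  moreover have "coroots (\<Union>\<beta>\<in>\<Lambda>. root_class \<beta>) = (\<Union>\<beta>\<in>\<Lambda>. coroots (root_class \<beta>))"
    unfolding coroots_def by blast
  ultimately show ?thesis by simp
qed

text \<open>By orthogonality \<open>h\<close> commutes with every root vector of weight \<beta>, but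
  it also acts on it by the scalar \<beta>(h).\<close>

lemma root_vanishes_on_other_class:
  assumes a: "\<alpha> \<in> \<Lambda>" and b: "\<beta> \<in> root_class \<alpha>"
    and g: "\<gamma> \<in> \<Lambda>" "\<gamma> \<notin> root_class \<alpha>" and h: "h \<in> coroots (root_class \<gamma>)"
  shows "\<beta> h = 0"
proof -
  have hH: "h \<in> H" using h coroots_H by blast
  have bL: "\<beta> \<in> \<Lambda>" using a b root_class_roots by auto
  obtain x where x: "x \<in> RS \<beta>" "x \<noteq> 0" using root_space_nonzero[OF bL] .
  have "br x h = 0"
    by (rule class_gens_orthogonal[OF a g]) (use x b h in \<open>auto simp: class_gens_def\<close>)
  then have "br h x = 0" using skew[OF RS_L[OF x(1)] H_L[OF hH]] by simp
  then show ?thesis using RS_H[OF x(1) hH] x(2) by simp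
qed

text \<open>Perfectness made \<open>H\<close> the span of the coroots; off \<open>H\<close> both
  functions are 0 by the encoding of \<open>dual\<close>.\<close>

lemma dual_eqI_coroots:
  assumes "\<beta> \<in> dual scale H" "\<gamma> \<in> dual scale H" "\<And>h. h \<in> coroots \<Lambda> \<Longrightarrow> \<beta> h = \<gamma> h"
  shows "\<beta> = \<gamma>"
proof
  fix h
  show "\<beta> h = \<gamma> h"
  proof (cases "h \<in> H")
    case True
    then have "h \<in> class_cartan \<Lambda>" using H_eq_class_cartan by simp
    then have "h \<in> H \<and> \<beta> h = \<gamma> h"
    proof (induction rule: span_induct_alt)
      case base
      have "\<beta> (scale 0 0) = 0 * \<beta> 0" "\<gamma> (scale 0 0) = 0 * \<gamma> 0"
        using assms(1,2) subspace_0[OF H_sub(1)] unfolding dual_def by blast+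
      then show ?case using subspace_0[OF H_sub(1)] by simp
    next
      case (step c x y)
      then have xH: "x \<in> H" "y \<in> H" using coroots_H by auto
      then have cx: "scale c x \<in> H" by (intro subspace_scale H_sub)
      have "\<beta> (scale c x + y) = c * \<beta> x + \<beta> y" "\<gamma> (scale c x + y) = c * \<gamma> x + \<gamma> y"
        using assms(1,2) xH cx unfolding dual_def by simp_all
      then show ?case using step assms(3)[OF step(1)] subspace_add[OF H_sub(1) cx xH(2)] by simp
    qed
    then show ?thesis by simp
  next
    case False
    then show ?thesis using assms by (simp add: dual_def)
  qed
qed

text \<open>A root vanishes on the coroots of all other classes. If it vanished on those of its own
  class too, it would vanish on \<open>H\<close>. No claim is made about the particular bracket
  [L_\<beta>, L_-\<beta>].\<close>

lemma class_cartan_root_nonzero: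
  assumes a: "\<alpha> \<in> \<Lambda>" and b: "\<beta> \<in> root_class \<alpha>"
  shows "\<exists>h\<in>coroots (root_class \<alpha>). \<beta> h \<noteq> 0"
proof (rule ccontr)
  assume "\<not> ?thesis"
  then have no: "\<beta> h = 0" if "h \<in> coroots (root_class \<alpha>)" for h using that by blast
  have bL: "\<beta> \<in> \<Lambda>" using a b root_class_roots by auto
  have "\<beta> h = 0" if "h \<in> coroots \<Lambda>" for h
  proof -
    obtain \<gamma> where g: "\<gamma> \<in> \<Lambda>" "h \<in> coroots (root_class \<gamma>)"
      using \<open>h \<in> coroots \<Lambda>\<close> coroots_roots by blast
    show ?thesis
    proof (cases "\<gamma> \<in> root_class \<alpha>")
      case True
      then show ?thesis using no g root_class_eq by metis
    next
      case False
      then show ?thesis using root_vanishes_on_other_class[OF a b g(1) _ g(2)] by blast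
    qed
  qed
  then have "\<beta> = (\<lambda>_. 0)" by (intro dual_eqI_coroots roots_dual[OF bL] dual_zero)
  then show False using bL zero_notin_roots by simp
qed

text \<open>Root-multiplicativity along a connection only yields one of the two root spaces of
  \<open>\<plusminus>\<beta>\<close>; either one suffices to get the coroots of the class, and these act without common
  kernel on the root spaces of the class.\<close>

lemma class_ideal_subset:
  assumes J: "is_ideal scale br L J" and a: "\<alpha> \<in> \<Lambda>" and aJ: "RS \<alpha> \<subseteq> J"
  shows "class_ideal (root_class \<alpha>) \<subseteq> J"
proof -
  have JL: "subspace J" "J \<subseteq> L" using J by (auto simp: is_ideal_def)
  have id: "br x y \<in> J" if "x \<in> J" "y \<in> L" for x y
    using J that by (auto simp: is_ideal_def)
  have id': "br y x \<in> J" if "x \<in> J" "y \<in> L" for x y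
    using id[OF that] skew[of y x] that JL by (auto simp: subspace_neg)
  have plus: "RS (plus_root \<beta> \<gamma>) \<subseteq> J"
    if r: "\<beta> \<in> \<Lambda>" "\<gamma> \<in> \<Lambda>" "plus_root \<beta> \<gamma> \<in> \<Lambda>" and bJ: "RS \<beta> \<subseteq> J" for \<beta> \<gamma>
  proof -
    have "span {br x y | x y. x \<in> RS \<beta> \<and> y \<in> RS \<gamma>} \<noteq> {0}"
      using multiplicative r unfolding root_multiplicative_def bracket_space_def by blast
    \<comment> \<open>A nonzero span needs a nonzero generator; by one-dimensionality that single
      bracket already brings the whole root space of the sum into \<open>J\<close>.\<close>
    then have "\<not> {br x y | x y. x \<in> RS \<beta> \<and> y \<in> RS \<gamma>} \<subseteq> {0}"
      using span_minimal[OF _ subspace_single_0] subspace_0[OF subspace_span] by blast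
    then obtain x y where xy: "x \<in> RS \<beta>" "y \<in> RS \<gamma>" "br x y \<noteq> 0" by blast
    have "br x y \<in> J" using id xy(1) bJ RS_L[OF xy(2)] by blast
    then show ?thesis using RS_subset[OF r(3) JL(1) _ RS_br[OF xy(1,2)] xy(3)] by blast
  qed
  have half: "RS \<beta> \<subseteq> J \<or> RS (neg \<beta>) \<subseteq> J" if "root_step\<^sup>*\<^sup>* \<alpha> \<beta>" for \<beta>
    using that
  proof (induction rule: rtranclp_induct)
    case (step \<beta> \<gamma>)
    then have b: "\<beta> \<in> \<Lambda>" "\<gamma> \<in> \<Lambda>" by (auto simp: root_step_def)
    consider "\<gamma> = neg \<beta>" | \<eta> where "\<eta> \<in> \<Lambda>" "\<gamma> = plus_root \<beta> \<eta>"
      using step(2) by (auto simp: root_step_def)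
    then show ?case
    proof cases
      case 1
      then show ?thesis using step(3) by auto
    next
      case (2 \<eta>)
      \<comment> \<open>If only the root space of -\<beta> is known to lie in \<open>J\<close>, the
        link is followed with -\<eta> and arrives at -\<gamma>.\<close>
      have "neg \<gamma> = plus_root (neg \<beta>) (neg \<eta>)" using 2 by (simp add: fun_eq_iff)
      then show ?thesis
        using step(3) 2 b neg_root plus
        by metis
    qed
  qed (use aJ in blast)
  have co: "coroots (root_class \<alpha>) \<subseteq> J"
  proof
    fix h assume "h \<in> coroots (root_class \<alpha>)"
    then obtain x y \<beta> where h: "h = br x y" "root_step\<^sup>*\<^sup>* \<alpha> \<beta>" "x \<in> RS \<beta>" "y \<in> RS (neg \<beta>)"
      by (auto simp: coroots_def root_class_def)
    then show "h \<in> J" using half[OF h(2)] id id' RS_L by blast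
  qed
  have "RS \<beta> \<subseteq> J" if b: "\<beta> \<in> root_class \<alpha>" for \<beta>
  proof -
    have bL: "\<beta> \<in> \<Lambda>" using a b root_class_roots by auto
    obtain h where h: "h \<in> coroots (root_class \<alpha>)" "\<beta> h \<noteq> 0"
      using class_cartan_root_nonzero[OF a b] by blast
    obtain x where x: "x \<in> RS \<beta>" "x \<noteq> 0" using root_space_nonzero[OF bL] .
    have "br h x = scale (\<beta> h) x" using h coroots_H x by (intro RS_H) auto
    moreover have "br h x \<in> J" using h co x RS_L by (intro id) auto
    ultimately show ?thesis
      using x h by (intro RS_subset[OF bL JL(1), of "scale (\<beta> h) x"]) (auto intro: subspace_scale subspace_RS)
  qed
  then show ?thesis using co JL by (intro span_minimal) (auto simp: class_gens_def)
qed

end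

section \<open>Minimal ideals\<close>

lemma connection_sum_1: "connection_sum 1 a (Suc 0) = a 1"
  by (simp add: connection_sum_def)

text \<open>All powers of \<delta> are 1, so these are ordinary partial sums. The bound on
  \<open>n\<close> matters: by truncated subtraction the value at index 0 is already
  \<open>a 1\<close>.\<close>

lemma connection_sum_Suc:
  "n \<ge> 1 \<Longrightarrow> connection_sum 1 a (Suc n) = (\<lambda>h. connection_sum 1 a n h + a (Suc n) h)"
  by (cases n) (auto simp: connection_sum_def fun_eq_iff)

lemma connection_sum_cong:
  "k \<ge> 1 \<Longrightarrow> (\<And>i. i \<in> {1..k} \<Longrightarrow> a i = b i) \<Longrightarrow> connection_sum \<delta> a k = connection_sum \<delta> b k"
  by (auto simp: connection_sum_def fun_eq_iff intro!: sum.cong)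

lemma connected_roots_refl: "\<alpha> \<in> \<Lambda> \<Longrightarrow> connected_roots 1 \<Lambda> \<alpha> \<alpha>"
  unfolding connected_roots_def
  by (rule exI[of _ 1], rule exI[of _ "\<lambda>_. \<alpha>"]) (simp add: connection_sum_1)

lemma connected_roots_neg: "connected_roots \<delta> \<Lambda> \<alpha> \<beta> \<Longrightarrow> connected_roots \<delta> \<Lambda> \<alpha> (\<lambda>h. - \<beta> h)"
  unfolding connected_roots_def by force

text \<open>A chain for \<beta> may end at -\<beta>. Appending -\<eta> in that case gives -(\<beta>
  + \<eta>), which the definition accepts as well.\<close>

lemma connected_roots_plus:
  assumes conn: "connected_roots 1 \<Lambda> \<alpha> \<beta>" and sym: "symmetric_roots \<Lambda>"
    and b: "\<beta> \<in> \<Lambda>" and e: "\<eta> \<in> \<Lambda>"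
  shows "connected_roots 1 \<Lambda> \<alpha> (\<lambda>h. \<beta> h + \<eta> h)"
proof -
  obtain n a where n: "n \<ge> 1" "\<forall>i\<in>{1..n}. a i \<in> \<Lambda>" "a 1 = \<alpha>"
    "\<forall>k\<in>{1..<n}. connection_sum 1 a k \<in> \<Lambda>"
    and c: "connection_sum 1 a n = \<beta> \<or> connection_sum 1 a n = (\<lambda>h. - \<beta> h)"
    using conn unfolding connected_roots_def by blast
  define \<eta>' where "\<eta>' = (if connection_sum 1 a n = \<beta> then \<eta> else (\<lambda>h. - \<eta> h))"
  define a' where "a' = a(Suc n := \<eta>')"
  have e': "\<eta>' \<in> \<Lambda>" using e sym by (simp add: \<eta>'_def symmetric_roots_def)
  have old: "connection_sum 1 a' k = connection_sum 1 a k" if "k \<in> {1..n}" for k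
    using that by (intro connection_sum_cong) (auto simp: a'_def)
  \<comment> \<open>The old endpoint becomes an intermediate sum of the longer chain, so it must
    itself be a root.\<close>
  have nR: "connection_sum 1 a n \<in> \<Lambda>" using c b sym by (auto simp: symmetric_roots_def)
  have "connection_sum 1 a' (Suc n) = (\<lambda>h. connection_sum 1 a n h + \<eta>' h)"
    using n(1) old[of n] by (simp add: connection_sum_Suc a'_def)
  then have "connection_sum 1 a' (Suc n) = (\<lambda>h. \<beta> h + \<eta> h) \<or>
      connection_sum 1 a' (Suc n) = (\<lambda>h. - (\<beta> h + \<eta> h))"
    using c by (auto simp: \<eta>'_def)
  moreover have "\<forall>i\<in>{1..Suc n}. a' i \<in> \<Lambda>" using n(2) e' by (auto simp: a'_def)
  moreover have "a' 1 = \<alpha>" using n(1,3) by (simp add: a'_def)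
  moreover have "\<forall>k\<in>{1..<Suc n}. connection_sum 1 a' k \<in> \<Lambda>"
  proof
    fix k assume k: "k \<in> {1..<Suc n}"
    then show "connection_sum 1 a' k \<in> \<Lambda>"
      using old[of k] n(4) nR by (cases "k = n") auto
  qed
  ultimately show ?thesis
    unfolding connected_roots_def by (intro exI[of _ "Suc n"] exI[of _ a']) simp
qed

section \<open>Class ideals as minimal ideals\<close>

context perfect_split_lie
begin

text \<open>Elements of the class ideal have components only at 0 and at roots of the class, so the
  class can be read off from its ideal.\<close>

lemma class_ideal_contains_RS:
  assumes a: "\<alpha> \<in> \<Lambda>" and b: "\<beta> \<in> \<Lambda>" "RS \<beta> \<subseteq> class_ideal (root_class \<alpha>)"
  shows "\<beta> \<in> root_class \<alpha>"
proof (rule ccontr)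
  assume "\<beta> \<notin> root_class \<alpha>"
  moreover have "\<beta> \<noteq> (\<lambda>_. 0)" using b zero_notin_roots by blast
  moreover obtain x where x: "x \<in> RS \<beta>" "x \<noteq> 0" using root_space_nonzero[OF b(1)] .
  ultimately have "component x \<beta> = 0"
    using component_class_ideal(2)[OF root_class_roots[OF a], of x \<beta>] b(2) by blast
  then show False using component_in_RS[OF x(1) b(1)] x(2) by simp
qed

lemma class_ideal_nonzero:
  assumes "\<alpha> \<in> \<Lambda>" shows "class_ideal (root_class \<alpha>) \<noteq> {0}"
  using root_space_nonzero[OF assms] RS_class_ideal[OF root_class_self] by blast

lemma minimal_ideal_iff:
  "minimal_ideal scale br L I \<longleftrightarrow> (\<exists>\<alpha>\<in>\<Lambda>. I = class_ideal (root_class \<alpha>))"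
proof
  assume I: "minimal_ideal scale br L I"
  then have I': "is_ideal scale br L I" "I \<noteq> {0}" by (simp_all add: minimal_ideal_def)
  have min: "J = {0} \<or> J = I" if "is_ideal scale br L J" "J \<subseteq> I" for J
    using I that by (simp add: minimal_ideal_def)
  obtain \<alpha> where a: "\<alpha> \<in> \<Lambda>" "RS \<alpha> \<subseteq> I" using nonzero_ideal_contains_RS[OF I'] by blast
  have "I = class_ideal (root_class \<alpha>)"
    using min[OF is_ideal_class_ideal[OF a(1)] class_ideal_subset[OF I'(1) a]]
      class_ideal_nonzero[OF a(1)] by simp
  then show "\<exists>\<alpha>\<in>\<Lambda>. I = class_ideal (root_class \<alpha>)" using a by blast
next
  assume "\<exists>\<alpha>\<in>\<Lambda>. I = class_ideal (root_class \<alpha>)"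
  then obtain \<alpha> where a: "\<alpha> \<in> \<Lambda>" "I = class_ideal (root_class \<alpha>)" by blast
  have "J = I" if J: "is_ideal scale br L J" "J \<subseteq> I" "J \<noteq> {0}" for J
  proof -
    obtain \<beta> where b: "\<beta> \<in> \<Lambda>" "RS \<beta> \<subseteq> J" using nonzero_ideal_contains_RS J by blast
    then have "root_class \<beta> = root_class \<alpha>"
      using class_ideal_contains_RS[OF a(1)] J a(2) root_class_eq by blast
    then show ?thesis using class_ideal_subset[OF J(1) b] J(2) a(2) by auto
  qed
  moreover have "is_ideal scale br L I" "I \<noteq> {0}"
    using is_ideal_class_ideal[OF a(1)] class_ideal_nonzero[OF a(1)] a(2) by simp_all
  ultimately show "minimal_ideal scale br L I" unfolding minimal_ideal_def by blast
qed

lemma minimal_ideals_orthogonal: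
  assumes "minimal_ideal scale br L I" "minimal_ideal scale br L J" "I \<noteq> J" "x \<in> I" "y \<in> J"
  shows "br x y = 0"
proof -
  obtain \<alpha> \<beta> where "\<alpha> \<in> \<Lambda>" "I = class_ideal (root_class \<alpha>)" "\<beta> \<in> \<Lambda>" "J = class_ideal (root_class \<beta>)"
    using assms(1,2) minimal_ideal_iff by auto
  moreover from this have "\<beta> \<notin> root_class \<alpha>" using root_class_eq assms(3) by metis
  ultimately show ?thesis using class_ideal_orthogonal assms(4,5) by blast
qed

lemma L_eq_span_minimal_ideals: "L = span (\<Union>I\<in>{I. minimal_ideal scale br L I}. I)"
proof
  have "class_gens \<Lambda> \<subseteq> (\<Union>I\<in>{I. minimal_ideal scale br L I}. I)"
    unfolding class_gens_roots minimal_ideal_iff using span_superset by blast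
  then show "L \<subseteq> span (\<Union>I\<in>{I. minimal_ideal scale br L I}. I)"
    using L_eq_class_gens span_mono by metis
  show "span (\<Union>I\<in>{I. minimal_ideal scale br L I}. I) \<subseteq> L"
    by (intro span_L) (auto simp: minimal_ideal_def is_ideal_def)
qed

text \<open>Used with \<open>S\<close> = {0} to prove centrality, and with \<open>S\<close> an ideal
  of a minimal ideal to show that it is an ideal of \<open>L\<close>.\<close>

lemma br_minimal_ideals:
  assumes "x \<in> L" "subspace S" "\<And>I y. minimal_ideal scale br L I \<Longrightarrow> y \<in> I \<Longrightarrow> br x y \<in> S" "y \<in> L"
  shows "br x y \<in> S"
proof (rule br_span)
  show "{x} \<subseteq> L" using assms by simp
  show "(\<Union>I\<in>{I. minimal_ideal scale br L I}. I) \<subseteq> L"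
    by (auto simp: minimal_ideal_def is_ideal_def)
  show "y \<in> span (\<Union>I\<in>{I. minimal_ideal scale br L I}. I)" using assms(4) L_eq_span_minimal_ideals by simp
  show "x \<in> span {x}" by (simp add: span_base)
qed (use assms in auto)

text \<open>In a vanishing sum the term \<open>f I\<close> commutes with every other minimal ideal
  by orthogonality, and with \<open>I\<close> because there it equals minus the sum of the other
  terms. So it is central, hence 0.\<close>

lemma direct_sum_minimal_ideals: "direct_sum L {I. minimal_ideal scale br L I} (\<lambda>I. I)"
proof (rule direct_sumI)
  show "subspace I" if "I \<in> {I. minimal_ideal scale br L I}" for I
    using that by (simp add: minimal_ideal_def is_ideal_def)
  show IL: "I \<subseteq> L" if "I \<in> {I. minimal_ideal scale br L I}" for I
    using that by (simp add: minimal_ideal_def is_ideal_def)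
  show "L \<subseteq> span (\<Union>I\<in>{I. minimal_ideal scale br L I}. I)"
    using L_eq_span_minimal_ideals by blast
  fix F f
  assume F: "finite F" "F \<subseteq> {I. minimal_ideal scale br L I}"
    and f: "\<And>I. I \<in> F \<Longrightarrow> f I \<in> I" and 0: "sum f F = 0"
  show "\<forall>I\<in>F. f I = 0"
  proof
    fix I assume I: "I \<in> F"
    have fL: "f J \<in> L" if "J \<in> F" for J using f[OF that] IL F that by blast
    have "br (f I) y \<in> {0}" if J: "minimal_ideal scale br L J" "y \<in> J" for J y
    proof (cases "J = I")
      case True
      have yL: "y \<in> L" using J IL by blast
      have "0 = br y (sum f F)" using 0 yL by simp
      also have "\<dots> = (\<Sum>J\<in>F. br y (f J))" by (rule br_sum_right[OF yL fL])
      also have "\<dots> = br y (f I) + (\<Sum>J\<in>F - {I}. br y (f J))" by (rule sum.remove[OF F(1) I])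
      also have "(\<Sum>J\<in>F - {I}. br y (f J)) = 0"
      proof (rule sum.neutral, rule ballI)
        fix K assume "K \<in> F - {I}"
        then show "br y (f K) = 0"
          using minimal_ideals_orthogonal[OF J(1), of K y "f K"] J(2) True f[of K] F by blast
      qed
      finally have "br y (f I) = 0" by simp
      then show ?thesis using skew[OF fL[OF I] yL] by simp
    next
      case False
      then show ?thesis
        using minimal_ideals_orthogonal[OF _ J(1) _ f[OF I] J(2)] F I by blast
    qed
    then have "br (f I) x \<in> {0}" if "x \<in> L" for x
      using br_minimal_ideals[OF fL[OF I] subspace_single_0 _ that] by blast
    then have "f I \<in> center br L" using fL[OF I] by (simp add: center_def)
    then show "f I = 0" using centerless by simp
  qed
qed

text \<open>The other minimal ideals annihilate \<open>I\<close>, so an ideal of \<open>I\<close> is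
  an ideal of \<open>L\<close> and minimality applies. The bracket on \<open>I\<close> is not zero
  because some coroot of the class acts on L_\<alpha> by a nonzero scalar.\<close>

lemma simple_minimal_ideal:
  assumes I: "minimal_ideal scale br L I"
  shows "simple_algebra scale br I"
proof -
  have IL: "I \<subseteq> L" using I by (simp add: minimal_ideal_def is_ideal_def)
  obtain \<alpha> where a: "\<alpha> \<in> \<Lambda>" and Ia: "I = class_ideal (root_class \<alpha>)" using I minimal_ideal_iff by blast
  obtain h where h: "h \<in> coroots (root_class \<alpha>)" "\<alpha> h \<noteq> 0"
    using class_cartan_root_nonzero[OF a root_class_self] by blast
  obtain x where x: "x \<in> RS \<alpha>" "x \<noteq> 0" using root_space_nonzero[OF a] .
  have "br h x = scale (\<alpha> h) x" using h(1) coroots_H x by (intro RS_H) auto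
  then have "br h x \<noteq> 0" using x h by simp
  moreover have "h \<in> I" using h(1) Ia coroots_class_ideal by blast
  moreover have "x \<in> I" using x(1) Ia RS_class_ideal[OF root_class_self] by blast
  ultimately have "bracket_space scale br I I \<noteq> {0}"
    unfolding bracket_space_def using span_superset[of "{br a b |a b. a \<in> I \<and> b \<in> I}"] by blast
  moreover have "J = {0} \<or> J = I" if J: "is_ideal scale br I J" for J
  proof -
    have J': "subspace J" "J \<subseteq> I" "J \<subseteq> L" using J IL by (auto simp: is_ideal_def)
    have "br x y \<in> J" if x: "x \<in> J" and y: "y \<in> L" for x y
    proof (rule br_minimal_ideals[OF _ J'(1) _ y])
      show "x \<in> L" using x J' by blast
      fix K z assume K: "minimal_ideal scale br L K" "z \<in> K"
      show "br x z \<in> J"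
      proof (cases "K = I")
        case True
        then show ?thesis using J x K by (simp add: is_ideal_def)
      next
        case False
        then have "br x z = 0" using minimal_ideals_orthogonal[OF I K(1)] x K(2) J' by blast
        then show ?thesis using J' by (simp add: subspace_0)
      qed
    qed
    then have "is_ideal scale br L J" using J' by (simp add: is_ideal_def)
    then show ?thesis using I J' by (simp add: minimal_ideal_def)
  qed
  ultimately show ?thesis by (simp add: simple_algebra_def)
qed

section \<open>Cartan subalgebra and roots of a class ideal\<close>

lemma root_spaces_independent:
  assumes "finite F" "F \<subseteq> insert (\<lambda>_. 0) \<Lambda>" "\<And>\<beta>. \<beta> \<in> F \<Longrightarrow> g \<beta> \<in> RS \<beta>" "sum g F = 0" "\<beta> \<in> F"
  shows "g \<beta> = 0"
proof -
  \<comment> \<open>Extending \<open>g\<close> by 0 off \<open>F\<close> makes it a decomposition of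
    the vector 0, which has only the zero one.\<close>
  have "component 0 = (\<lambda>\<beta>. if \<beta> \<in> F then g \<beta> else 0)"
  proof (rule component_eqI[OF _ _ _ _ assms(1)])
    show "(if (\<lambda>_. 0) \<in> F then g (\<lambda>_. 0) else 0) \<in> H"
      using assms(3) RS_zero H_sub by (auto simp: subspace_0)
    show "(if \<alpha> \<in> F then g \<alpha> else 0) \<in> RS \<alpha>" for \<alpha>
      using assms(3) by (auto simp: subspace_0 subspace_RS)
    show "(if \<alpha> \<in> F then g \<alpha> else 0) = 0" if "\<alpha> \<notin> insert (\<lambda>_. 0) \<Lambda>" for \<alpha>
      using that assms(2) by auto
    show "0 = (\<Sum>\<beta>\<in>F. if \<beta> \<in> F then g \<beta> else 0)" using assms(4) by simp
  qed auto
  moreover have "component 0 = (\<lambda>_. 0)" using component_scale[of 0 0] by simp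
  ultimately show ?thesis using assms(5) by (auto dest: fun_cong[of _ _ \<beta>])
qed

lemma class_functional_vanishes:
  assumes "\<alpha> \<in> \<Lambda>" "\<beta> \<in> insert (\<lambda>_. 0) (root_class \<alpha>)" "\<gamma> \<in> \<Lambda>" "\<gamma> \<notin> root_class \<alpha>"
    "h \<in> coroots (root_class \<gamma>)"
  shows "\<beta> h = 0"
  using root_vanishes_on_other_class[OF assms(1) _ assms(3,4,5), of \<beta>] assms(2) by auto

lemma class_functional_dual:
  "\<alpha> \<in> \<Lambda> \<Longrightarrow> \<beta> \<in> insert (\<lambda>_. 0) (root_class \<alpha>) \<Longrightarrow> \<beta> \<in> dual scale H"
  using root_class_roots[of \<alpha>] roots_dual[of \<beta>] dual_zero by blast

text \<open>On coroots of other classes both sides of the eigenvalue equation vanish, so it extends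
  from the coroots of the class to all coroots and by linearity to \<open>H\<close>.\<close>

lemma eigenvector_class_cartan:
  assumes a: "\<alpha> \<in> \<Lambda>" and b: "\<beta> \<in> insert (\<lambda>_. 0) (root_class \<alpha>)"
    and v: "v \<in> class_ideal (root_class \<alpha>)"
    and e: "\<And>h. h \<in> coroots (root_class \<alpha>) \<Longrightarrow> br h v = scale (\<beta> h) v"
  shows "v \<in> RS \<beta>"
proof -
  have vL: "v \<in> L" using v class_ideal_L by blast
  have bd: "\<beta> \<in> dual scale H" by (rule class_functional_dual[OF a b])
  have gen: "br h v = scale (\<beta> h) v" if h: "h \<in> coroots \<Lambda>" for h
  proof -
    obtain \<gamma> where g: "\<gamma> \<in> \<Lambda>" "h \<in> coroots (root_class \<gamma>)"
      using h coroots_roots by blast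
    show ?thesis
    proof (cases "\<gamma> \<in> root_class \<alpha>")
      case True
      then show ?thesis using e g root_class_eq by metis
    next
      case False
      have "h \<in> class_ideal (root_class \<gamma>)" using g(2) coroots_class_ideal by blast
      moreover have "\<alpha> \<notin> root_class \<gamma>" using False root_class_eq root_class_self by metis
      ultimately have "br h v = 0" using class_ideal_orthogonal[OF g(1) a _ _ v] by blast
      then show ?thesis using class_functional_vanishes[OF a b g(1) False g(2)] by simp
    qed
  qed
  have "br h v = scale (\<beta> h) v" if "h \<in> H" for h
  proof -
    have "h \<in> class_cartan \<Lambda>" using that H_eq_class_cartan by simp
    then have "h \<in> H \<and> br h v = scale (\<beta> h) v"
    proof (induction rule: span_induct_alt)
      case base
      have "\<beta> (scale 0 0) = 0 * \<beta> 0"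
        using bd subspace_0[OF H_sub(1)] unfolding dual_def by blast
      then show ?case using subspace_0[OF H_sub(1)] vL by simp
    next
      case (step c x y)
      then have xH: "x \<in> H" "y \<in> H" using coroots_H by auto
      then have cx: "scale c x \<in> H" by (intro subspace_scale H_sub)
      have "\<beta> (scale c x + y) = c * \<beta> x + \<beta> y"
        using bd xH cx unfolding dual_def by simp
      moreover have "br (scale c x + y) v = scale c (br x v) + br y v"
        using xH vL by (simp add: br_add_left br_scale_left)
      ultimately show ?case
        using step gen[OF step(1)] subspace_add[OF H_sub(1) cx xH(2)] by (simp add: scale_left_distrib)
    qed
    then show ?thesis by simp
  qed
  then show ?thesis using vL by (simp add: root_space_def)
qed

text \<open>The value 0 off the smaller Cartan subalgebra is what membership in its
  \<open>dual\<close> demands.\<close>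

definition restrict_root :: "('v \<Rightarrow> 'k) \<Rightarrow> ('v \<Rightarrow> 'k) \<Rightarrow> 'v \<Rightarrow> 'k" where
  "restrict_root \<alpha> \<beta> = (\<lambda>h. if h \<in> class_cartan (root_class \<alpha>) then \<beta> h else 0)"

lemma restrict_root_zero: "restrict_root \<alpha> (\<lambda>_. 0) = (\<lambda>_. 0)"
  by (simp add: restrict_root_def)

text \<open>Both functionals vanish on the coroots of other classes, so agreement on those of the
  class is agreement everywhere. Including 0 in the domain shows that restricted roots are
  nonzero.\<close>

lemma inj_on_restrict_root:
  assumes a: "\<alpha> \<in> \<Lambda>"
  shows "inj_on (restrict_root \<alpha>) (insert (\<lambda>_. 0) (root_class \<alpha>))"
proof (rule inj_onI)
  fix \<beta> \<gamma>
  assume b: "\<beta> \<in> insert (\<lambda>_. 0) (root_class \<alpha>)" and c: "\<gamma> \<in> insert (\<lambda>_. 0) (root_class \<alpha>)"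
    and eq: "restrict_root \<alpha> \<beta> = restrict_root \<alpha> \<gamma>"
  show "\<beta> = \<gamma>"
  proof (rule dual_eqI_coroots)
    fix h assume "h \<in> coroots \<Lambda>"
    then obtain \<eta> where g: "\<eta> \<in> \<Lambda>" "h \<in> coroots (root_class \<eta>)" using coroots_roots by blast
    show "\<beta> h = \<gamma> h"
    proof (cases "\<eta> \<in> root_class \<alpha>")
      case True
      then have "h \<in> class_cartan (root_class \<alpha>)" using g root_class_eq span_base by metis
      then show ?thesis using fun_cong[OF eq, of h] by (simp add: restrict_root_def)
    next
      case False
      then show ?thesis
        using class_functional_vanishes[OF a b g(1) _ g(2)] class_functional_vanishes[OF a c g(1) _ g(2)] by simp
    qed
  qed (use class_functional_dual[OF a] b c in blast)+
qed

lemma root_space_class_ideal: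
  assumes a: "\<alpha> \<in> \<Lambda>" and b: "\<beta> \<in> insert (\<lambda>_. 0) (root_class \<alpha>)"
  shows "root_space scale br (class_ideal (root_class \<alpha>)) (class_cartan (root_class \<alpha>)) (restrict_root \<alpha> \<beta>)
    = class_ideal (root_class \<alpha>) \<inter> RS \<beta>"
proof (intro equalityI subsetI)
  fix v
  assume v: "v \<in> root_space scale br (class_ideal (root_class \<alpha>)) (class_cartan (root_class \<alpha>)) (restrict_root \<alpha> \<beta>)"
  then have vI: "v \<in> class_ideal (root_class \<alpha>)" by (simp add: root_space_def)
  moreover have "v \<in> RS \<beta>"
    using v span_base by (intro eigenvector_class_cartan[OF a b vI]) (auto simp: root_space_def restrict_root_def)
  ultimately show "v \<in> class_ideal (root_class \<alpha>) \<inter> RS \<beta>" by blast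
next
  fix v assume "v \<in> class_ideal (root_class \<alpha>) \<inter> RS \<beta>"
  then show "v \<in> root_space scale br (class_ideal (root_class \<alpha>)) (class_cartan (root_class \<alpha>)) (restrict_root \<alpha> \<beta>)"
    using class_cartan_H[of "root_class \<alpha>"] by (auto simp: root_space_def restrict_root_def)
qed

lemma roots_class_ideal:
  assumes a: "\<alpha> \<in> \<Lambda>"
  shows "roots scale br (class_ideal (root_class \<alpha>)) (class_cartan (root_class \<alpha>))
    = restrict_root \<alpha> ` root_class \<alpha>" (is "?R = _")
proof (intro equalityI subsetI)
  let ?I = "class_ideal (root_class \<alpha>)" let ?K = "class_cartan (root_class \<alpha>)"
  fix \<gamma> assume g: "\<gamma> \<in> ?R"
  have 0: "0 \<in> root_space scale br ?I ?K \<gamma>"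
    using class_cartan_H[of "root_class \<alpha>"] H_sub by (auto simp: root_space_def span_zero)
  then obtain v where v: "v \<in> root_space scale br ?I ?K \<gamma>" "v \<noteq> 0" using g unfolding roots_def by blast
  then have vI: "v \<in> ?I" and vL: "v \<in> L" using class_ideal_L by (auto simp: root_space_def)
  \<comment> \<open>The vector \<open>v\<close> is only known to be a weight vector for the smaller
    Cartan subalgebra. Any nonzero component with respect to \<open>H\<close> has a weight that must
    restrict to \<gamma>.\<close>
  have "\<exists>\<beta>. component v \<beta> \<noteq> 0"
  proof (rule ccontr)
    assume "\<nexists>\<beta>. component v \<beta> \<noteq> 0"
    then have "v = sum (component v) {}" by (intro sum_component_superset[OF vL]) auto
    then show False using v by simp
  qed
  then obtain \<beta> where b: "component v \<beta> \<noteq> 0" by blast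
  then have bC: "\<beta> \<in> insert (\<lambda>_. 0) (root_class \<alpha>)"
    using component_class_ideal(2)[OF root_class_roots[OF a] vI] by blast
  have "\<beta> h = \<gamma> h" if h: "h \<in> ?K" for h
  proof -
    have hH: "h \<in> H" using h class_cartan_H by blast
    have "scale (\<beta> h) (component v \<beta>) = component (br h v) \<beta>" using component_br[OF vL hH] by simp
    also have "br h v = scale (\<gamma> h) v" using v h by (simp add: root_space_def)
    also have "component \<dots> \<beta> = scale (\<gamma> h) (component v \<beta>)" using component_scale[OF vL] by simp
    finally show ?thesis using b by simp
  qed
  moreover have "\<gamma> h = 0" if "h \<notin> ?K" for h using g that by (simp add: roots_def dual_def)
  ultimately have gb: "\<gamma> = restrict_root \<alpha> \<beta>" by (auto simp: restrict_root_def fun_eq_iff)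
  then have "\<beta> \<noteq> (\<lambda>_. 0)" using g restrict_root_zero zero_notin_roots by (auto simp: roots_def)
  then show "\<gamma> \<in> restrict_root \<alpha> ` root_class \<alpha>" using gb bC by blast
next
  let ?I = "class_ideal (root_class \<alpha>)" let ?K = "class_cartan (root_class \<alpha>)"
  fix \<gamma> assume "\<gamma> \<in> restrict_root \<alpha> ` root_class \<alpha>"
  then obtain \<beta> where b: "\<beta> \<in> root_class \<alpha>" "\<gamma> = restrict_root \<alpha> \<beta>" by blast
  have bL: "\<beta> \<in> \<Lambda>" using b a root_class_roots by blast
  have "\<gamma> \<in> dual scale ?K"
    using roots_dual[OF bL] class_cartan_H[of "root_class \<alpha>"] unfolding b(2)
    by (auto simp: dual_def restrict_root_def subset_iff intro: span_add span_scale)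
  moreover have "\<gamma> \<noteq> (\<lambda>_. 0)"
  proof
    assume "\<gamma> = (\<lambda>_. 0)"
    then have "\<beta> = (\<lambda>_. 0)"
      using inj_onD[OF inj_on_restrict_root[OF a], of \<beta> "\<lambda>_. 0"] b restrict_root_zero by simp
    then show False using bL zero_notin_roots by blast
  qed
  moreover have "root_space scale br ?I ?K \<gamma> = RS \<beta>"
    using root_space_class_ideal[OF a, of \<beta>] RS_class_ideal[OF b(1)] b by auto
  moreover have "RS \<beta> \<noteq> {0}" using root_space_nonzero[OF bL] by blast
  ultimately show "\<gamma> \<in> ?R" unfolding roots_def by simp
qed

lemma splitting_cartan_class_ideal:
  assumes a: "\<alpha> \<in> \<Lambda>"
  shows "splitting_cartan scale br 1 (class_ideal (root_class \<alpha>)) (class_cartan (root_class \<alpha>))"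
proof -
  let ?C = "root_class \<alpha>" let ?I = "class_ideal ?C" let ?K = "class_cartan ?C"
  have KH: "?K \<subseteq> H" by (rule class_cartan_H)
  have IH: "?I \<inter> H = ?K" by (rule class_ideal_inter_H[OF root_class_roots[OF a]])
  have "maximal_abelian_subalgebra scale br ?I ?K"
    unfolding maximal_abelian_subalgebra_def
  proof (intro conjI allI impI)
    show "abelian_subalgebra scale br ?I ?K"
      unfolding abelian_subalgebra_def using class_cartan_ideal
      by (auto intro: H_abelian subsetD[OF KH])
    fix A assume A: "abelian_subalgebra scale br ?I A \<and> ?K \<subseteq> A"
    \<comment> \<open>Since \<open>A\<close> is abelian and contains the coroots of the class,
      \<open>x\<close> is an eigenvector for the functional 0, hence lies in \<open>H\<close> as
      well as in the class ideal.\<close>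
    have "x \<in> ?K" if x: "x \<in> A" for x
    proof -
      have xI: "x \<in> ?I" using A x by (auto simp: abelian_subalgebra_def)
      have "br h x = scale 0 x" if "h \<in> coroots ?C" for h
      proof -
        have "h \<in> A" using A span_base[OF that] by blast
        then show ?thesis using A x by (simp add: abelian_subalgebra_def)
      qed
      then have "x \<in> RS (\<lambda>_. 0)" using eigenvector_class_cartan[OF a _ xI, of "\<lambda>_. 0"] by blast
      then show ?thesis using xI IH RS_zero by blast
    qed
    then show "A = ?K" using A by blast
  qed
  moreover have "ad_simultaneously_diagonalizable scale br 1 ?I ?K"
  proof -
    \<comment> \<open>A basis chosen among the generators consists of weight vectors for
      \<open>H\<close>.\<close>
    obtain B where B: "B \<subseteq> class_gens ?C" "independent B" "class_gens ?C \<subseteq> span B"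
      using maximal_independent_subset[of "class_gens ?C"] by blast
    have "span B = ?I"
      by (rule span_eq[THEN iffD2]) (use B span_superset in blast)
    moreover have "\<exists>c. ad scale br 1 h b = scale c b" if b: "b \<in> B" and h: "h \<in> ?K" for b h
    proof (cases "b \<in> coroots ?C")
      case True
      then have "br h b = 0" using h KH coroots_H by (intro H_abelian) auto
      then show ?thesis by (intro exI[of _ 0]) (simp add: ad_def)
    next
      case False
      then obtain \<beta> where "b \<in> RS \<beta>" using b B by (auto simp: class_gens_def)
      then have "br h b = scale (\<beta> h) b" using h KH by (intro RS_H) auto
      then show ?thesis by (auto simp: ad_def)
    qed
    moreover have "B \<subseteq> ?I" using B(1) span_superset[of "class_gens ?C"] by (rule order_trans)
    ultimately show ?thesis
      unfolding ad_simultaneously_diagonalizable_def by (intro exI[of _ B] conjI ballI B(2))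
  qed
  moreover have "root_decomposition scale br ?I ?K"
  proof -
    define V where "V = (\<lambda>\<gamma>. if \<gamma> = (\<lambda>_. 0) then ?K else root_space scale br ?I ?K \<gamma>)"
    define D where "D = insert (\<lambda>_. 0) ?C"
    have D: "insert (\<lambda>_. 0) (roots scale br ?I ?K) = restrict_root \<alpha> ` D"
      unfolding roots_class_ideal[OF a] D_def by (simp add: restrict_root_zero)
    have inj: "inj_on (restrict_root \<alpha>) D" unfolding D_def by (rule inj_on_restrict_root[OF a])
    have DL: "D \<subseteq> insert (\<lambda>_. 0) \<Lambda>" using root_class_roots[OF a] by (auto simp: D_def)
    have V: "V (restrict_root \<alpha> \<beta>) = ?I \<inter> RS \<beta>" if b: "\<beta> \<in> D" for \<beta>
    proof (cases "\<beta> = (\<lambda>_. 0)")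
      case True
      then show ?thesis using IH RS_zero by (simp add: V_def restrict_root_zero)
    next
      case False
      \<comment> \<open>Injectivity on \<open>D\<close>, which contains 0, keeps a root out of the
        branch of \<open>V\<close> reserved for the Cartan summand.\<close>
      then have "restrict_root \<alpha> \<beta> \<noteq> (\<lambda>_. 0)"
        using inj_onD[OF inj, of \<beta> "\<lambda>_. 0"] b by (auto simp: restrict_root_zero D_def)
      then show ?thesis using root_space_class_ideal[OF a] b by (simp add: V_def D_def)
    qed
    have "direct_sum ?I (restrict_root \<alpha> ` D) V"
    proof (rule direct_sumI)
      show "subspace (V \<gamma>)" if "\<gamma> \<in> restrict_root \<alpha> ` D" for \<gamma>
        using that V subspace_inter[OF subspace_span subspace_RS] by auto
      show "V \<gamma> \<subseteq> ?I" if "\<gamma> \<in> restrict_root \<alpha> ` D" for \<gamma>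
        using that V by auto
      have "coroots ?C \<subseteq> V (restrict_root \<alpha> (\<lambda>_. 0))"
        by (auto simp: V_def restrict_root_zero span_base)
      moreover have "RS \<beta> \<subseteq> V (restrict_root \<alpha> \<beta>)" if "\<beta> \<in> ?C" for \<beta>
        using V[of \<beta>] RS_class_ideal[OF that] that by (simp add: D_def)
      ultimately have "class_gens ?C \<subseteq> (\<Union>\<gamma>\<in>restrict_root \<alpha> ` D. V \<gamma>)"
        unfolding class_gens_def D_def by blast
      then show "?I \<subseteq> span (\<Union>\<gamma>\<in>restrict_root \<alpha> ` D. V \<gamma>)" by (rule span_mono)
      fix F f
      assume F: "finite F" "F \<subseteq> restrict_root \<alpha> ` D" and f: "\<And>\<gamma>. \<gamma> \<in> F \<Longrightarrow> f \<gamma> \<in> V \<gamma>"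
        and 0: "sum f F = 0"
      \<comment> \<open>The index set is pulled back along the injective restriction, where
        independence of the weight spaces of \<open>H\<close> applies.\<close>
      obtain E where E: "E \<subseteq> D" "F = restrict_root \<alpha> ` E" using F(2) by (auto simp: subset_image_iff)
      have injE: "inj_on (restrict_root \<alpha>) E" using inj E(1) by (rule inj_on_subset)
      have "finite E" using F(1) E(2) injE finite_image_iff by blast
      moreover have "(\<Sum>\<beta>\<in>E. f (restrict_root \<alpha> \<beta>)) = 0"
        using 0 unfolding E(2) by (simp add: sum.reindex[OF injE])
      moreover have "f (restrict_root \<alpha> \<beta>) \<in> RS \<beta>" if "\<beta> \<in> E" for \<beta>
        using f[of "restrict_root \<alpha> \<beta>"] V[of \<beta>] E that by blast
      ultimately have "f (restrict_root \<alpha> \<beta>) = 0" if "\<beta> \<in> E" for \<beta>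
        using root_spaces_independent[of E "\<lambda>\<beta>. f (restrict_root \<alpha> \<beta>)" \<beta>] E DL that by blast
      then show "\<forall>\<gamma>\<in>F. f \<gamma> = 0" using E(2) by blast
    qed
    then show ?thesis unfolding root_decomposition_def V_def D .
  qed
  ultimately show ?thesis by (simp add: splitting_cartan_def)
qed

lemma symmetric_roots_class_ideal:
  assumes a: "\<alpha> \<in> \<Lambda>"
  shows "symmetric_roots (restrict_root \<alpha> ` root_class \<alpha>)"
proof -
  have "(\<lambda>h. - restrict_root \<alpha> \<beta> h) = restrict_root \<alpha> (neg \<beta>)" for \<beta>
    by (auto simp: restrict_root_def)
  then show ?thesis using root_class_neg[OF a] by (auto simp: symmetric_roots_def)
qed

lemma all_roots_connected_class_ideal:
  assumes a: "\<alpha> \<in> \<Lambda>"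
  shows "all_roots_connected 1 (restrict_root \<alpha> ` root_class \<alpha>)"
proof -
  let ?R = "restrict_root \<alpha> ` root_class \<alpha>"
  have "connected_roots 1 ?R (restrict_root \<alpha> \<beta>) (restrict_root \<alpha> \<gamma>)"
    if b: "\<beta> \<in> root_class \<alpha>" and g: "\<gamma> \<in> root_class \<alpha>" for \<beta> \<gamma>
  proof -
    have "root_step\<^sup>*\<^sup>* \<beta> \<gamma>" using g root_class_eq[OF b] by (auto simp: root_class_def)
    then show ?thesis
    proof (induction rule: rtranclp_induct)
      case base
      show ?case using b by (intro connected_roots_refl) auto
    next
      case (step \<eta> \<gamma>)
      have e: "\<eta> \<in> root_class \<alpha>" using step(1) root_class_eq[OF b] by (auto simp: root_class_def)
      consider "\<gamma> = neg \<eta>" | \<zeta> where "\<zeta> \<in> \<Lambda>" "\<gamma> = plus_root \<eta> \<zeta>" "\<gamma> \<in> \<Lambda>"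
        using step(2) by (auto simp: root_step_def)
      then show ?case
      proof cases
        case 1
        then have "restrict_root \<alpha> \<gamma> = (\<lambda>h. - restrict_root \<alpha> \<eta> h)" by (auto simp: restrict_root_def)
        then show ?thesis using connected_roots_neg[OF step(3)] by simp
      next
        case (2 \<zeta>)
        \<comment> \<open>The chain has to run through restricted roots, so the added root must lie
          in the class as well, not just in \<Lambda>.\<close>
        then have "\<zeta> \<in> root_class \<alpha>" using root_class_plus_right[OF a e] by blast
        moreover have "restrict_root \<alpha> \<gamma> = (\<lambda>h. restrict_root \<alpha> \<eta> h + restrict_root \<alpha> \<zeta> h)"
          using 2 by (auto simp: restrict_root_def)
        ultimately show ?thesis
          using connected_roots_plus[OF step(3) symmetric_roots_class_ideal[OF a]] e by simp
      qed
    qed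
  qed
  then show ?thesis by (auto simp: all_roots_connected_def)
qed

theorem minimal_ideal_decomposition:
  "direct_sum L {I. minimal_ideal scale br L I} (\<lambda>I. I) \<and>
    (\<forall>I. minimal_ideal scale br L I \<longrightarrow>
       delta_jordan_lie scale br 1 I \<and> simple_algebra scale br I \<and>
       (\<exists>H\<^sub>I. splitting_cartan scale br 1 I H\<^sub>I \<and>
          symmetric_roots (roots scale br I H\<^sub>I) \<and>
          all_roots_connected 1 (roots scale br I H\<^sub>I)))"
proof (intro conjI allI impI direct_sum_minimal_ideals)
  fix I assume I: "minimal_ideal scale br L I"
  then obtain \<alpha> where a: "\<alpha> \<in> \<Lambda>" and Ia: "I = class_ideal (root_class \<alpha>)"
    using minimal_ideal_iff by blast
  show "delta_jordan_lie scale br 1 I" using I restrict_ideal by (simp add: minimal_ideal_def)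
  show "simple_algebra scale br I" by (rule simple_minimal_ideal[OF I])
  show "\<exists>H\<^sub>I. splitting_cartan scale br 1 I H\<^sub>I \<and> symmetric_roots (roots scale br I H\<^sub>I) \<and>
          all_roots_connected 1 (roots scale br I H\<^sub>I)"
    unfolding Ia using splitting_cartan_class_ideal[OF a] symmetric_roots_class_ideal[OF a]
      all_roots_connected_class_ideal[OF a] roots_class_ideal[OF a] by metis
qed

end

section \<open>The case \<open>\<delta> = - 1\<close> and the conclusion\<close>

lemma commutative_case_no_roots:
  fixes scale :: "'k::field_char_0 \<Rightarrow> 'v::ab_group_add \<Rightarrow> 'v"
  assumes L: "delta_jordan_lie scale br (- 1) L" and H: "abelian_subalgebra scale br L H"
  shows "roots scale br L H = {}"
proof (rule equals0I)
  interpret delta_jordan_lie scale br "- 1" L by (rule L)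
  fix \<alpha> assume a: "\<alpha> \<in> roots scale br L H"
  have HL: "H \<subseteq> L" and ab: "\<And>h. h \<in> H \<Longrightarrow> br h h = 0" using H by (auto simp: abelian_subalgebra_def)
  have "0 \<in> root_space scale br L H \<alpha>" using HL by (auto simp: root_space_def)
  then obtain v where v: "v \<in> root_space scale br L H \<alpha>" "v \<noteq> 0" using a unfolding roots_def by blast
  then have vL: "v \<in> L" by (simp add: root_space_def)
  have "\<alpha> h = 0" if h: "h \<in> H" for h
  proof -
    have hL: "h \<in> L" using h HL by blast
    have e: "br h v = scale (\<alpha> h) v" using v h by (simp add: root_space_def)
    \<comment> \<open>Jacobi with both outer arguments \<open>h\<close>. For \<delta> = -1 the
      bracket is symmetric, so [h, h] = 0 comes from \<open>H\<close> being abelian.\<close>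
    have "br h (br h v) = - br h (br h v)"
      using br_jacobi[OF hL hL vL] ab[OF h] vL by simp
    moreover have "br h (br h v) = scale (\<alpha> h * \<alpha> h) v"
      using hL vL by (simp add: e br_scale_right)
    ultimately have "scale (\<alpha> h * \<alpha> h + \<alpha> h * \<alpha> h) v = 0"
      by (simp only: scale_left_distrib) (metis add.right_inverse)
    \<comment> \<open>Characteristic 0 now allows division by 2.\<close>
    then have "\<alpha> h * \<alpha> h + \<alpha> h * \<alpha> h = 0" using v(2) by simp
    then show ?thesis by (simp flip: mult_2)
  qed
  moreover have "\<alpha> h = 0" if "h \<notin> H" for h using a that by (simp add: roots_def dual_def)
  ultimately have "\<alpha> = (\<lambda>_. 0)" by blast
  then show False using a by (simp add: roots_def)
qed

lemma commutative_case_trivial: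
  fixes scale :: "'k::field_char_0 \<Rightarrow> 'v::ab_group_add \<Rightarrow> 'v"
  assumes L: "delta_jordan_lie scale br (- 1) L" and H: "splitting_cartan scale br (- 1) L H"
    and perfect: "bracket_space scale br L L = L"
  shows "L = {0}"
proof -
  interpret delta_jordan_lie scale br "- 1" L by (rule L)
  have Ha: "abelian_subalgebra scale br L H"
    using H by (simp add: splitting_cartan_def maximal_abelian_subalgebra_def)
  then have H0: "0 \<in> H" by (simp add: abelian_subalgebra_def subspace_0)
  have "L \<subseteq> H"
  proof
    fix v assume v: "v \<in> L"
    \<comment> \<open>Without roots the decomposition has \<open>H\<close> as its only
      summand.\<close>
    have "direct_sum L {\<lambda>_. 0} (\<lambda>\<alpha>. if \<alpha> = (\<lambda>_. 0) then H else root_space scale br L H \<alpha>)"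
      using H commutative_case_no_roots[OF L Ha] by (simp add: splitting_cartan_def root_decomposition_def)
    then obtain f where "\<forall>\<alpha>\<in>{\<lambda>_. 0}. f \<alpha> \<in> (if \<alpha> = (\<lambda>_. 0) then H else root_space scale br L H \<alpha>)"
      "\<forall>\<alpha>. \<alpha> \<notin> {\<lambda>_. 0} \<longrightarrow> f \<alpha> = 0" and sum: "v = (\<Sum>\<alpha>\<in>{\<alpha>. f \<alpha> \<noteq> 0}. f \<alpha>)"
      using v unfolding direct_sum_def by blast
    then have f: "f (\<lambda>_. 0) \<in> H" "\<forall>\<alpha>. \<alpha> \<noteq> (\<lambda>_. 0) \<longrightarrow> f \<alpha> = 0" by simp_all
    have "v = sum f {\<lambda>_. 0}" unfolding sum by (rule sum.mono_neutral_left) (use f(2) in auto)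
    then show "v \<in> H" using f(1) by simp
  qed
  then have "{br a b |a b. a \<in> L \<and> b \<in> L} \<subseteq> {0}" using Ha by (auto simp: abelian_subalgebra_def)
  then have "bracket_space scale br L L \<subseteq> {0}"
    unfolding bracket_space_def by (intro span_minimal subspace_single_0)
  then show ?thesis using perfect by auto
qed

theorem theorem3p6:
  fixes scale :: "'k::field_char_0 \<Rightarrow> 'v::ab_group_add \<Rightarrow> 'v"
    and br :: "'v \<Rightarrow> 'v \<Rightarrow> 'v"
    and \<delta> :: 'k
    and L H :: "'v set"
  assumes "delta_jordan_lie scale br \<delta> L"
    and "splitting_cartan scale br \<delta> L H"
    and "symmetric_roots (roots scale br L H)"
    and "root_multiplicative scale br L H"
    and "center br L = {0}"
    and "bracket_space scale br L L = L"
    and "\<forall>\<alpha>\<in>roots scale br L H. vector_space.dim scale (root_space scale br L H \<alpha>) = 1"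
  shows "direct_sum L {I. minimal_ideal scale br L I} (\<lambda>I. I) \<and>
    (\<forall>I. minimal_ideal scale br L I \<longrightarrow>
       delta_jordan_lie scale br \<delta> I \<and> simple_algebra scale br I \<and>
       (\<exists>H\<^sub>I. splitting_cartan scale br \<delta> I H\<^sub>I \<and>
          symmetric_roots (roots scale br I H\<^sub>I) \<and>
          all_roots_connected \<delta> (roots scale br I H\<^sub>I)))"
proof -
  interpret J: delta_jordan_lie scale br \<delta> L by (rule assms(1))
  consider "\<delta> = 1" | "\<delta> = - 1" using J.delta by blast
  then show ?thesis
  proof cases
    case 1
    interpret perfect_split_lie scale br L H
      using assms unfolding 1
      by (intro perfect_split_lie.intro split_lie.intro split_lie_axioms.intro perfect_split_lie_axioms.intro) auto
    show ?thesis using minimal_ideal_decomposition unfolding 1 .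
  next
    case 2
    then have L0: "L = {0}" using commutative_case_trivial assms(1,2,6) by blast
    then have no: "\<not> minimal_ideal scale br L I" for I
      using J.subspace_0 by (auto simp: minimal_ideal_def is_ideal_def)
    \<comment> \<open>The zero algebra has no minimal ideals, as these are nonzero, so what remains
      is that {0} is the empty direct sum.\<close>
    have "direct_sum L {} (\<lambda>I. I)"
      unfolding direct_sum_def L0
    proof (intro conjI ballI)
      fix v assume "v \<in> {0::'v}"
      then show "\<exists>!f. (\<forall>I\<in>{}. f I \<in> I) \<and> (\<forall>I. I \<notin> {} \<longrightarrow> f I = 0) \<and>
          finite {I. f I \<noteq> 0} \<and> v = (\<Sum>I\<in>{I. f I \<noteq> 0}. f I)"
        by (intro ex1I[of _ "\<lambda>_. 0"]) auto
    qed simp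
    then show ?thesis using no by simp
  qed
qed

end
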